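(* Consider the real-valued block-sparse setting in the context with Gaussian noise $w\sim N(0,\sigma^2 I_L)$, and assume $x\ne0$. Suppose that for some constant $\alpha\ge 1/(2d\log N)$, $$(1-(d-1)\nu)x_{\min}-(2k-1)d\mu_B x_{\min}\ \ge\ 2\sigma\sqrt{2\alpha d(1+(d-1)\nu)\log N}.$$ Then, with probability exceeding $$1-\frac{0.8\,d\,(2\alpha d\log N)^{d/2-1}}{N^{\alpha d-1}},$$ the BOMP algorithm selects every element of $S$ among $\{i_1,\dots,i_k\}$ and $$\|\hat x_{\mathrm{BOMP}}-x\|_2^2\le\frac{2\alpha(1+(d-1)\nu)}{(1-(d-1)\nu-(k-1)d\mu_B)^2}\,d\,k\,\sigma^2\log N.$$
   Context: Setting: $N=Md$, $\log$ is the natural logarithm. For $v\in\mathbb{R}^N$, $v[i]=(v_{(i-1)d+1},\dots,v_{id})^T$ is its $i$-th block ($1\le i\le M$); for a matrix $A$ with $N$ columns, $A[i]$ is the submatrix of columns $(i-1)d+1,\dots,id$. The block support is $\mathrm{supp}(v)=\{i:v[i]\ne0\}$; for $I=\{i_1<\dots<i_p\}$, $A_I=[A[i_1],\dots,A[i_p]]$. The unknown deterministic $x\in\mathbb{R}^N$ has at most $k$ nonzero blocks ($k$ known); $S=\mathrm{supp}(x)$, $s=|S|$, $x_{\max}=\max_{i\in S}\|x[i]\|_2$, $x_{\min}=\min_{i\in S}\|x[i]\|_2$. Observations $y=Dx+w$, with $D\in\mathbb{R}^{L\times N}$ known, columns $d_1,\dots,d_N$ of unit $\ell_2$ norm, $L<N$,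 and $D_I$ of full column rank for all $|I|\le k$. Block coherence $\mu_B=\max_{i\ne j}\frac1d\|D[i]^TD[j]\|$ (spectral norm); sub-coherence $\nu=\max_{1\le\ell\le M}\max_{(\ell-1)d+1\le i\ne j\le\ell d}|d_i^Td_j|$. BOMP algorithm: set $r^0=y$. For $\ell=1,\dots,k$: choose $i_\ell\in\arg\max_i\|D[i]^Tr^{\ell-1}\|_2$ (ties arbitrary); let $x^\ell$ minimize $\|y-D\tilde x\|_2$ over $\tilde x$ with $\mathrm{supp}(\tilde x)\subseteq\{i_1,\dots,i_\ell\}$; set $r^\ell=y-Dx^\ell$. Output $\hat x_{\mathrm{BOMP}}=x^k$. *)

theory Defs
  imports "HOL-Probability.Probability"
begin

text \<open>Conventions: indices are 0-based. Vectors in R^n are functions nat => real,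
only entries 0..n-1 being relevant. The L x N dictionary is D :: nat => nat => real
(row l < L, column j < N). With N = M*d, column j belongs to block j div d (< M).\<close>

definition sqnorm :: "nat \<Rightarrow> (nat \<Rightarrow> real) \<Rightarrow> real" where
  "sqnorm n v = (\<Sum>l<n. (v l)\<^sup>2)"

definition mat_vec :: "nat \<Rightarrow> nat \<Rightarrow> (nat \<Rightarrow> nat \<Rightarrow> real) \<Rightarrow> (nat \<Rightarrow> real) \<Rightarrow> (nat \<Rightarrow> real)" where
  "mat_vec L N D v = (\<lambda>l. \<Sum>j<N. D l j * v j)"

definition block_norm :: "nat \<Rightarrow> (nat \<Rightarrow> real) \<Rightarrow> nat \<Rightarrow> real" where
  "block_norm d v i = sqrt (\<Sum>a<d. (v (i * d + a))\<^sup>2)"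

definition block_supp :: "nat \<Rightarrow> nat \<Rightarrow> (nat \<Rightarrow> real) \<Rightarrow> nat set" where
  "block_supp M d v = {i. i < M \<and> (\<exists>a<d. v (i * d + a) \<noteq> 0)}"

definition spec_norm :: "nat \<Rightarrow> nat \<Rightarrow> (nat \<Rightarrow> nat \<Rightarrow> real) \<Rightarrow> real" where
  "spec_norm m n A = Sup {sqrt (\<Sum>r<m. (\<Sum>c<n. A r c * u c)\<^sup>2) | u. (\<Sum>c<n. (u c)\<^sup>2) \<le> 1}"

definition block_gram :: "nat \<Rightarrow> nat \<Rightarrow> (nat \<Rightarrow> nat \<Rightarrow> real) \<Rightarrow> nat \<Rightarrow> nat \<Rightarrow> (nat \<Rightarrow> nat \<Rightarrow> real)" where
  "block_gram L d D i j = (\<lambda>a b. \<Sum>l<L. D l (i * d + a) * D l (j * d + b))"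

text \<open>Block coherence mu_B (convention: 0 if there is only one block; all terms are \<ge> 0).\<close>
definition block_coherence :: "nat \<Rightarrow> nat \<Rightarrow> nat \<Rightarrow> (nat \<Rightarrow> nat \<Rightarrow> real) \<Rightarrow> real" where
  "block_coherence L M d D =
     Max (insert 0 {spec_norm d d (block_gram L d D i j) / real d | i j. i < M \<and> j < M \<and> i \<noteq> j})"

text \<open>Sub-coherence nu (convention: 0 if d = 1; all terms are \<ge> 0).\<close>
definition sub_coherence :: "nat \<Rightarrow> nat \<Rightarrow> nat \<Rightarrow> (nat \<Rightarrow> nat \<Rightarrow> real) \<Rightarrow> real" where
  "sub_coherence L M d D =
     Max (insert 0 {\<bar>\<Sum>l<L. D l (i * d + a) * D l (i * d + b)\<bar> | i a b. i < M \<and> a < d \<and> b < d \<and> a \<noteq> b})"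

definition block_corr :: "nat \<Rightarrow> nat \<Rightarrow> (nat \<Rightarrow> nat \<Rightarrow> real) \<Rightarrow> (nat \<Rightarrow> real) \<Rightarrow> nat \<Rightarrow> real" where
  "block_corr L d D r i = sqrt (\<Sum>a<d. (\<Sum>l<L. D l (i * d + a) * r l)\<^sup>2)"

definition supported_in :: "nat \<Rightarrow> nat \<Rightarrow> (nat \<Rightarrow> real) \<Rightarrow> nat set \<Rightarrow> bool" where
  "supported_in N d v I \<longleftrightarrow> (\<forall>j<N. j div d \<notin> I \<longrightarrow> v j = 0)"

text \<open>A run of BOMP on data y: chosen indices idx 0, ..., idx (k-1) (i.e. i_1..i_k) and
iterates xs 0, ..., xs (k-1) (i.e. x^1..x^k). Ties in the argmax are arbitrary, and
x^l is any least-squares minimizer over vectors supported on the chosen blocks.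
The residual before step l (0-based) is y for l = 0 and y - D x^(l) otherwise.\<close>
definition bomp_residual :: "nat \<Rightarrow> nat \<Rightarrow> (nat \<Rightarrow> nat \<Rightarrow> real) \<Rightarrow> (nat \<Rightarrow> real)
     \<Rightarrow> (nat \<Rightarrow> nat \<Rightarrow> real) \<Rightarrow> nat \<Rightarrow> (nat \<Rightarrow> real)" where
  "bomp_residual L N D y xs l =
     (if l = 0 then y else (\<lambda>r. y r - mat_vec L N D (xs (l - 1)) r))"

definition bomp_run :: "nat \<Rightarrow> nat \<Rightarrow> nat \<Rightarrow> (nat \<Rightarrow> nat \<Rightarrow> real) \<Rightarrow> nat \<Rightarrow> (nat \<Rightarrow> real)
     \<Rightarrow> (nat \<Rightarrow> nat) \<Rightarrow> (nat \<Rightarrow> nat \<Rightarrow> real) \<Rightarrow> bool" where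
  "bomp_run L M d D k y idx xs \<longleftrightarrow>
     (\<forall>l<k.
        idx l < M \<and>
        (\<forall>i<M. block_corr L d D (bomp_residual L (M * d) D y xs l) i
                \<le> block_corr L d D (bomp_residual L (M * d) D y xs l) (idx l)) \<and>
        supported_in (M * d) d (xs l) (idx ` {..l}) \<and>
        (\<forall>z. supported_in (M * d) d z (idx ` {..l}) \<longrightarrow>
              sqnorm L (\<lambda>r. y r - mat_vec L (M * d) D (xs l) r)
                \<le> sqnorm L (\<lambda>r. y r - mat_vec L (M * d) D z r)))"

definition gauss_noise :: "nat \<Rightarrow> real \<Rightarrow> (nat \<Rightarrow> real) measure" where
  "gauss_noise L \<sigma> = PiM {..<L} (\<lambda>_. density lborel (normal_density 0 \<sigma>))"

end

theory Submission
  imports Defs "HOL-Real_Asymp.Real_Asymp"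
begin

text \<open>All that is used of the noise is the event that every block of \<open>D\<^sup>T w\<close> has norm below
  \<open>\<tau> = \<sigma> sqrt ((1 + (d - 1) \<nu>) t)\<close> with \<open>t = 2 \<alpha> d ln N\<close>.

  Probability of the event. Since the Gram matrix of a block is bounded by \<open>1 + (d - 1) \<nu>\<close>, the
  norm of the \<open>i\<close>-th block of \<open>D\<^sup>T w\<close> is at most \<open>sqrt (1 + (d - 1) \<nu>)\<close> times that of the
  projection of \<open>w\<close> onto the span of the block's columns, whose squared length is \<open>\<sigma>\<^sup>2\<close> times a
  chi-square variable with at most \<open>d\<close> degrees of freedom. That distribution is identified by its Laplace transform at the natural
  numbers, that is, by the moments of \<open>exp (- X)\<close>. Integration by parts bounds its tail at \<open>t \<ge> 1\<close>
  by \<open>0.8 d\<^sup>2 t powr (d / 2 - 1) exp (- t / 2)\<close>; a union bound over the \<open>M = N / d\<close> blocks follows.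

  Recovery on the event. As long as a block of \<open>S\<close> is missing, the error \<open>e\<close> of the current iterate
  is supported on \<open>S\<close> and its largest block has norm at least \<open>xmin\<close>. The coherence bounds then make
  the correlation of that block with the residual larger than that of every block outside \<open>S\<close>, while
  blocks already chosen have zero correlation by the normal equations; so a new block of \<open>S\<close> is
  chosen. At the end the normal equations read \<open>D[i]\<^sup>T D e = D[i]\<^sup>T w\<close> up to sign on the chosen
  blocks, and diagonal dominance of the block Gram matrix bounds \<open>e\<close>.\<close>

subsection \<open>Distributions on the unit interval with equal moments\<close>

text \<open>By Weierstrass, \<open>f\<close> is within \<open>e/2\<close> of a polynomial on the
  unit interval. Polynomials have equal expectations by linearity, and total mass 1 keeps each
  approximation error at most \<open>e/2\<close>.\<close>

lemma integral_continuous_eq_of_moments: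
  fixes M1 :: "'a measure" and M2 :: "'b measure" and U :: "'a \<Rightarrow> real" and V :: "'b \<Rightarrow> real"
    and f :: "real \<Rightarrow> real"
  assumes "prob_space M1" "prob_space M2"
    and U[measurable]: "U \<in> borel_measurable M1" and V[measurable]: "V \<in> borel_measurable M2"
    and U01: "\<And>x. U x \<in> {0..1}" and V01: "\<And>x. V x \<in> {0..1}"
    and mom: "\<And>n::nat. (\<integral>x. U x ^ n \<partial>M1) = (\<integral>x. V x ^ n \<partial>M2)"
    and f: "continuous_on UNIV f"
  shows "(\<integral>x. f (U x) \<partial>M1) = (\<integral>x. f (V x) \<partial>M2)"
proof -
  interpret P1: prob_space M1 by fact
  interpret P2: prob_space M2 by fact
  have fm[measurable]: "f \<in> borel_measurable borel"
    using f by (rule borel_measurable_continuous_onI)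
  have intU: "integrable M1 (\<lambda>x. g (U x))" and intV: "integrable M2 (\<lambda>x. g (V x))"
    if "continuous_on UNIV g" for g :: "real \<Rightarrow> real"
  proof -
    have [measurable]: "g \<in> borel_measurable borel"
      using that by (rule borel_measurable_continuous_onI)
    have "compact (g ` {0..1})"
      by (intro compact_continuous_image continuous_on_subset[OF that]) auto
    then obtain B where B: "\<And>u. u \<in> {0..1} \<Longrightarrow> norm (g u) \<le> B"
      by (meson compact_imp_bounded bounded_iff imageI)
    show "integrable M1 (\<lambda>x. g (U x))"
      by (rule P1.integrable_const_bound[where B = B]) (use B U01 in auto)
    show "integrable M2 (\<lambda>x. g (V x))"
      by (rule P2.integrable_const_bound[where B = B]) (use B V01 in auto)
  qed
  have poly: "(\<integral>x. (\<Sum>k\<le>n. c k * U x ^ k) \<partial>M1) = (\<integral>x. (\<Sum>k\<le>n. c k * V x ^ k) \<partial>M2)" for n :: nat and c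
  proof -
    have "integrable M1 (\<lambda>x. c k * U x ^ k)" "integrable M2 (\<lambda>x. c k * V x ^ k)" for k
      by (intro intU[of "\<lambda>u. c k * u ^ k"] intV[of "\<lambda>u. c k * u ^ k"] continuous_intros)+
    then show ?thesis
      by (simp add: mom)
  qed
  have "\<bar>(\<integral>x. f (U x) \<partial>M1) - (\<integral>x. f (V x) \<partial>M2)\<bar> \<le> e" if "e > 0" for e
  proof -
    have "e/2 > 0" using that by simp
    from Stone_Weierstrass_real_polynomial_function[OF compact_Icc continuous_on_subset[OF f subset_UNIV] this]
    obtain g where g: "real_polynomial_function g" "\<And>u. u \<in> {0..1} \<Longrightarrow> \<bar>f u - g u\<bar> < e/2"
      by blast
    then obtain c n where gc: "g = (\<lambda>u. \<Sum>k\<le>n. c k * u ^ k)"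
      using real_polynomial_function_iff_sum by blast
    have gcont: "continuous_on UNIV g" unfolding gc by (intro continuous_intros)
    have 1: "\<bar>(\<integral>x. f (U x) \<partial>M1) - (\<integral>x. g (U x) \<partial>M1)\<bar> \<le> e/2"
    proof -
      have "\<bar>\<integral>x. f (U x) - g (U x) \<partial>M1\<bar> \<le> (\<integral>x. \<bar>f (U x) - g (U x)\<bar> \<partial>M1)"
        by simp
      also have "\<dots> \<le> (\<integral>x. e/2 \<partial>M1)"
        using intU[OF f] intU[OF gcont]
        by (intro integral_mono integrable_abs Bochner_Integration.integrable_diff less_imp_le[OF g(2)] U01) auto
      finally show ?thesis using intU[OF f] intU[OF gcont] by (simp add: P1.prob_space)
    qed
    have 2: "\<bar>(\<integral>x. f (V x) \<partial>M2) - (\<integral>x. g (V x) \<partial>M2)\<bar> \<le> e/2"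
    proof -
      have "\<bar>\<integral>x. f (V x) - g (V x) \<partial>M2\<bar> \<le> (\<integral>x. \<bar>f (V x) - g (V x)\<bar> \<partial>M2)"
        by simp
      also have "\<dots> \<le> (\<integral>x. e/2 \<partial>M2)"
        using intV[OF f] intV[OF gcont]
        by (intro integral_mono integrable_abs Bochner_Integration.integrable_diff less_imp_le[OF g(2)] V01) auto
      finally show ?thesis using intV[OF f] intV[OF gcont] by (simp add: P2.prob_space)
    qed
    have 3: "(\<integral>x. g (U x) \<partial>M1) = (\<integral>x. g (V x) \<partial>M2)"
      unfolding gc by (rule poly)
    from 1 2 3 show ?thesis by linarith
  qed
  then have "\<bar>(\<integral>x. f (U x) \<partial>M1) - (\<integral>x. f (V x) \<partial>M2)\<bar> \<le> 0"
    by (rule dense_ge)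
  then show ?thesis by simp
qed

text \<open>The indicator of a half-line is a pointwise limit of continuous functions with values in
  the unit interval, so dominated convergence carries the previous equality over to distribution
  functions.\<close>

lemma prob_le_eq_of_moments:
  fixes M1 :: "'a measure" and M2 :: "'b measure" and U :: "'a \<Rightarrow> real" and V :: "'b \<Rightarrow> real"
  assumes P1: "prob_space M1" and P2: "prob_space M2"
    and U: "U \<in> borel_measurable M1" and V: "V \<in> borel_measurable M2"
    and U01: "\<And>x. U x \<in> {0..1}" and V01: "\<And>x. V x \<in> {0..1}"
    and mom: "\<And>n::nat. (\<integral>x. U x ^ n \<partial>M1) = (\<integral>x. V x ^ n \<partial>M2)"
  shows "measure M1 {x \<in> space M1. U x \<le> a} = measure M2 {x \<in> space M2. V x \<le> a}"
proof -
  \<comment> \<open>For \<open>n > 0\<close> a ramp: 1 up to \<open>a\<close>, then slope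
    \<open>-n\<close> down to 0 at \<open>a + 1/n\<close>. Descending only to the right of
    \<open>a\<close> makes the limit the indicator of the closed half-line.\<close>
  define f where "f = (\<lambda>(n::nat) u. max 0 (min 1 (1 - real n * (u - a))) :: real)"
  have fcont: "continuous_on UNIV (f n)" for n
    unfolding f_def by (intro continuous_intros)
  have flim: "(\<lambda>n. f n u) \<longlonglongrightarrow> indicator {..a} u" for u
  proof (cases "u \<le> a")
    case True
    then have "f n u = 1" for n
      unfolding f_def by (auto simp: mult_nonneg_nonpos)
    then show ?thesis using True by simp
  next
    case False
    have "\<forall>\<^sub>F n in sequentially. 1 / (u - a) \<le> real n"
      by real_asymp
    then have "\<forall>\<^sub>F n in sequentially. f n u = 0"
      by eventually_elim (use False in \<open>auto simp: f_def field_simps\<close>)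
    then show ?thesis using False by (simp add: tendsto_eventually)
  qed
  have lim: "(\<lambda>n. \<integral>x. f n (W x) \<partial>M) \<longlonglongrightarrow> measure M {x \<in> space M. W x \<le> a}"
    if "prob_space M" and W[measurable]: "W \<in> borel_measurable M" for M :: "'c measure" and W
  proof -
    interpret prob_space M by fact
    have [measurable]: "f n \<in> borel_measurable borel" for n
      using fcont by (rule borel_measurable_continuous_onI)
    have "(\<lambda>n. \<integral>x. f n (W x) \<partial>M) \<longlonglongrightarrow> (\<integral>x. indicator {..a} (W x) \<partial>M)"
      by (rule integral_dominated_convergence[where w = "\<lambda>_. 1"])
        (use flim in \<open>auto simp: f_def\<close>)
    also have "(\<integral>x. indicator {..a} (W x) \<partial>M) = (\<integral>x. indicator {x \<in> space M. W x \<le> a} x \<partial>M)"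
      by (intro Bochner_Integration.integral_cong) (auto simp: indicator_def)
    finally show ?thesis by simp
  qed
  have eq: "(\<integral>x. f n (U x) \<partial>M1) = (\<integral>x. f n (V x) \<partial>M2)" for n
    by (rule integral_continuous_eq_of_moments[OF assms fcont])
  show ?thesis
    using lim[OF P1 U] lim[OF P2 V] unfolding eq by (rule LIMSEQ_unique)
qed

subsection \<open>The tail of the chi-square distribution\<close>

text \<open>The Gamma density with shape \<open>p / 2\<close> and rate \<open>1/2\<close>. For
  \<open>p = 0\<close> the value is 0, since \<open>Gamma 0 = 0\<close> and division by 0 gives
  0.\<close>

definition chi_sq_density :: "nat \<Rightarrow> real \<Rightarrow> real" where
  "chi_sq_density p x =
     indicator {0..} x * (x powr (p / 2 - 1) * exp (- x / 2) / (2 powr (p / 2) * Gamma (p / 2)))"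

lemma chi_sq_density_nonneg: "0 \<le> chi_sq_density p x"
  unfolding chi_sq_density_def by (cases "p = 0") (auto simp: indicator_def intro!: divide_nonneg_nonneg mult_nonneg_nonneg less_imp_le[OF Gamma_real_pos])

lemma borel_measurable_chi_sq_density[measurable]: "chi_sq_density p \<in> borel_measurable borel"
  unfolding chi_sq_density_def[abs_def] by measurable

text \<open>The factor \<open>exp (- s * x)\<close> changes the rate from \<open>1/2\<close> to
  \<open>c = s + 1/2\<close>, so the substitution \<open>c * x\<close> leaves the Gamma
  integral.\<close>

lemma nn_integral_chi_sq_laplace:
  assumes "p > 0" "s \<ge> 0"
  shows "(\<integral>\<^sup>+x. ennreal (exp (- s * x) * chi_sq_density p x) \<partial>lborel) = ennreal ((1 + 2 * s) powr (- (p / 2)))"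
proof -
  define a where "a = real p / 2"
  define c where "c = s + 1/2"
  have a: "a > 0" and c: "c > 0" using assms by (auto simp: a_def c_def)
  have G: "Gamma a > 0" using a by (rule Gamma_real_pos)
  \<comment> \<open>What remains once \<open>x powr (a - 1)\<close> is written through
    \<open>c * x\<close> and the Jacobian \<open>c\<close> is split off.\<close>
  define K where "K = c powr (- a) / (2 powr a * Gamma a)"
  have K: "K \<ge> 0" using G by (auto simp: K_def)
  have "(\<integral>\<^sup>+x. ennreal (exp (- s * x) * chi_sq_density p x) \<partial>lborel)
      = (\<integral>\<^sup>+x. ennreal K * (ennreal \<bar>c\<bar> * ennreal (indicator {0..} (0 + c * x) * (0 + c * x) powr (a - 1) / exp (0 + c * x))) \<partial>lborel)"
  proof (rule nn_integral_cong)
    fix x :: real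
    have "exp (- s * x) * chi_sq_density p x =
       K * (\<bar>c\<bar> * (indicator {0..} (0 + c * x) * (0 + c * x) powr (a - 1) / exp (0 + c * x)))"
    proof (cases "x \<ge> 0")
      case True
      have "c powr (- a) * c * (c * x) powr (a - 1) = x powr (a - 1)"
        using c True by (simp add: powr_mult powr_diff powr_minus field_simps)
      moreover have "exp (- s * x) * exp (- x / 2) = inverse (exp (c * x))"
        by (simp add: c_def exp_add[symmetric] exp_minus[symmetric] algebra_simps)
      ultimately show ?thesis
        using True c G by (simp add: chi_sq_density_def K_def a_def[symmetric] field_simps)
    next
      case False
      then show ?thesis using c by (auto simp: chi_sq_density_def indicator_def zero_le_mult_iff)
    qed
    then show "ennreal (exp (- s * x) * chi_sq_density p x) =
      ennreal K * (ennreal \<bar>c\<bar> * ennreal (indicator {0..} (0 + c * x) * (0 + c * x) powr (a - 1) / exp (0 + c * x)))"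
      using K by (simp only: ennreal_mult[symmetric] abs_ge_zero) (simp add: ennreal_mult[symmetric] )
  qed
  also have "\<dots> = ennreal K * (ennreal \<bar>c\<bar> * (\<integral>\<^sup>+x. ennreal (indicator {0..} (0 + c * x) * (0 + c * x) powr (a - 1) / exp (0 + c * x)) \<partial>lborel))"
    by (simp add: nn_integral_cmult)
  also have "\<dots> = ennreal K * (\<integral>\<^sup>+x. ennreal (indicator {0..} x * x powr (a - 1) / exp x) \<partial>lborel)"
    using c by (subst nn_integral_real_affine[where c = c and t = 0 and f = "\<lambda>x. ennreal (indicator {0..} x * x powr (a - 1) / exp x)", symmetric]) auto
  also have "\<dots> = ennreal (K * Gamma a)"
    using K G a by (simp add: Gamma_conv_nn_integral_real[OF a, symmetric] ennreal_mult)
  also have "K * Gamma a = (2 * c) powr (- a)"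
    using G c by (simp add: K_def powr_mult powr_minus field_simps)
  finally show ?thesis by (simp add: a_def c_def algebra_simps)
qed

definition chi_sq :: "nat \<Rightarrow> real measure" where
  "chi_sq p = density lborel (chi_sq_density p)"

lemma prob_space_chi_sq: "p > 0 \<Longrightarrow> prob_space (chi_sq p)"
  using nn_integral_chi_sq_laplace[of p 0]
  by (intro prob_spaceI) (simp add: chi_sq_def emeasure_density)

lemma chi_sq_laplace:
  assumes "p > 0" "s \<ge> 0"
  shows "(\<integral>x. exp (- s * x) \<partial>chi_sq p) = (1 + 2 * s) powr (- (p / 2))"
proof -
  have "(\<integral>x. exp (- s * x) \<partial>chi_sq p) = enn2real (\<integral>\<^sup>+x. ennreal (exp (- s * x)) \<partial>chi_sq p)"
    by (rule integral_eq_nn_integral) (auto simp: chi_sq_def)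
  also have "(\<integral>\<^sup>+x. ennreal (exp (- s * x)) \<partial>chi_sq p) = (\<integral>\<^sup>+x. ennreal (exp (- s * x) * chi_sq_density p x) \<partial>lborel)"
    by (simp add: chi_sq_def nn_integral_density chi_sq_density_nonneg ennreal_mult[symmetric] mult.commute)
  finally show ?thesis
    using nn_integral_chi_sq_laplace[OF assms] by simp
qed

text \<open>The difference vanishes at 0 and has a nonnegative derivative, because
  \<open>(1 - y\<^sup>2) * (1 + y\<^sup>2) \<le> 1\<close>.\<close>

lemma arctan_ge_cubic:
  assumes "x \<ge> 0"
  shows "x - x ^ 3 / 3 \<le> arctan x"
proof -
  have "(\<lambda>x. arctan x - (x - x ^ 3 / 3)) 0 \<le> (\<lambda>x. arctan x - (x - x ^ 3 / 3)) x"
  proof (rule DERIV_nonneg_imp_nondecreasing[OF assms])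
    fix y :: real
    have "((\<lambda>x. arctan x - (x - x ^ 3 / 3)) has_real_derivative inverse (1 + y\<^sup>2) - (1 - y\<^sup>2)) (at y)"
      by (auto intro!: derivative_eq_intros)
    moreover have "(1 - y\<^sup>2) * (1 + y\<^sup>2) \<le> 1"
      by (simp add: algebra_simps flip: power2_eq_square)
    then have "1 - y\<^sup>2 \<le> inverse (1 + y\<^sup>2)"
      by (simp add: inverse_eq_divide pos_le_divide_eq add_pos_nonneg)
    ultimately show "\<exists>D. ((\<lambda>x. arctan x - (x - x ^ 3 / 3)) has_real_derivative D) (at y) \<and> 0 \<le> D"
      by (intro exI[of _ "inverse (1 + y\<^sup>2) - (1 - y\<^sup>2)"]) auto
  qed
  then show ?thesis by simp
qed

text \<open>\<open>3.125 = 2.5\<^sup>2 / 2\<close> is what \<open>2 / sqrt (2 * pi) < 0.8\<close>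
  requires. Euler's formula \<open>pi / 4 = 5 * arctan (1/7) + 2 * arctan (3/79)\<close> with the
  cubic bound reaches it.\<close>

lemma pi_gt_3_125: "pi > 3.125"
  using machin_Euler arctan_ge_cubic[of "1/7"] arctan_ge_cubic[of "3/79"]
  by (simp add: power3_eq_cube)

text \<open>Passing from \<open>q\<close> to \<open>q + 2\<close> multiplies the value by
  \<open>q + 2\<close>, and the case \<open>q = 1\<close> is \<open>sqrt (pi / 2) \<ge> 1\<close>.
  The bound controls the boundary term of the integration by parts below.\<close>

lemma one_le_two_powr_Gamma: "1 \<le> 2 powr (real q / 2) * Gamma (real q / 2 + 1)"
proof (induction q rule: less_induct)
  case (less q)
  consider "q = 0" | "q = 1" | r where "q = r + 2"
    by (metis One_nat_def Suc_1 add_2_eq_Suc' not0_implies_Suc)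
  then show ?case
  proof cases
    case 2
    have "Gamma (1/2 + 1 :: real) = 1/2 * sqrt pi"
      by (subst Gamma_plus1) (auto simp: Gamma_one_half_real)
    moreover have "2 \<le> sqrt 2 * sqrt pi"
      using pi_gt_3_125 by (auto intro!: real_le_rsqrt simp flip: real_sqrt_mult)
    ultimately have "1 \<le> sqrt 2 * Gamma (1/2 + 1 :: real)"
      by (simp only:)
    then show ?thesis
      by (simp add: 2 powr_half_sqrt)
  next
    case 3
    define a where "a = real r / 2"
    have a: "a \<ge> 0" by (simp add: a_def)
    have "1 \<le> 2 powr a * Gamma (a + 1)"
      using less.IH[of r] 3 by (simp add: a_def)
    also have "\<dots> \<le> 2 * (a + 1) * (2 powr a * Gamma (a + 1))"
      using a mult_right_mono[of 1 "2 * (a + 1)" "2 powr a * Gamma (a + 1)"] Gamma_real_pos[of "a + 1"]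
      by simp
    also have "\<dots> = 2 powr (a + 1) * Gamma (a + 1 + 1)"
      using a by (subst Gamma_plus1[of "a + 1"]) (auto simp: powr_add)
    also have "a + 1 = real q / 2" by (simp add: a_def 3)
    finally show ?thesis .
  qed auto
qed

text \<open>Integration by parts reduces \<open>p + 2\<close> to \<open>p\<close>:
  \<open>chi_sq_density (p + 2) - chi_sq_density p\<close> is minus the derivative of
  \<open>x powr (p / 2) * exp (- x / 2) / (2 powr (p / 2) * Gamma (p / 2 + 1))\<close>.\<close>

lemma chi_sq_tail_majorant:
  assumes "p > 0"
  shows "\<exists>H h. h \<in> borel_measurable borel \<and> (H \<longlongrightarrow> 0) at_top \<and>
     (\<forall>x\<ge>1. (H has_real_derivative - h x) (at x) \<and> chi_sq_density p x \<le> h x \<and>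
        H x < 0.8 * (real p)\<^sup>2 * x powr (p / 2 - 1) * exp (- x / 2))"
  using assms
proof (induction p rule: less_induct)
  case (less p)
  consider "p = 1" | "p = 2" | q where "p = q + 2" "q > 0"
    using less.prems by (metis One_nat_def Suc_1 add_2_eq_Suc' gr0_conv_Suc not_gr0)
  then show ?case
  proof cases
    case 1
    \<comment> \<open>Adding the term with exponent \<open>-3/2\<close> to the density for
      \<open>p = 1\<close> makes it exactly the derivative of \<open>- H\<close>.\<close>
    define h where "h = (\<lambda>x::real. (1 / sqrt (2 * pi)) * (x powr (-1/2) + x powr (-3/2)) * exp (- x / 2))"
    define H where "H = (\<lambda>x::real. (2 / sqrt (2 * pi)) * (x powr (-1/2) * exp (- x / 2)))"
    have "h \<in> borel_measurable borel" unfolding h_def by measurable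
    moreover have "(H \<longlongrightarrow> 0) at_top" unfolding H_def by real_asymp
    moreover have "(H has_real_derivative - h x) (at x)" if "x \<ge> 1" for x
    proof -
      have "((\<lambda>x. x powr (-1/2) * exp (- x / 2)) has_real_derivative
          - ((x powr (-1/2) + x powr (-3/2)) * exp (- x / 2) / 2)) (at x)"
        using that by (auto intro!: derivative_eq_intros simp: field_simps)
      from DERIV_cmult[OF this, of "2 / sqrt (2 * pi)"] show ?thesis
        unfolding H_def h_def by simp
    qed
    moreover have "chi_sq_density p x \<le> h x" if "x \<ge> 1" for x
    proof -
      have "chi_sq_density p x = (1 / sqrt (2 * pi)) * x powr (-1/2) * exp (- x / 2)"
        using that by (simp add: 1 chi_sq_density_def Gamma_one_half_real powr_half_sqrt real_sqrt_mult)
      then show ?thesis by (simp add: h_def field_simps)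
    qed
    moreover have "H x < 0.8 * (real p)\<^sup>2 * x powr (p / 2 - 1) * exp (- x / 2)" if "x \<ge> 1" for x
    proof -
      \<comment> \<open>The left side is about 0.798, so this case leaves the constant 0.8 almost no
        slack.\<close>
      have "2 / sqrt (2 * pi) < 0.8"
      proof -
        have "(2.5::real)\<^sup>2 < 2 * pi" using pi_gt_3_125 by (simp add: power2_eq_square)
        then have "2.5 < sqrt (2 * pi)" by (rule real_less_rsqrt)
        then show ?thesis by (simp add: field_simps)
      qed
      from mult_strict_right_mono[OF this, of "x powr (-1/2) * exp (- x / 2)"] that
      show ?thesis unfolding H_def 1 by (simp add: mult.assoc)
    qed
    ultimately show ?thesis by blast
  next
    case 2
    \<comment> \<open>For \<open>p = 2\<close> the density is exponential and \<open>H\<close> is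
      its exact tail; \<open>0.8 * 2\<^sup>2 > 1\<close> suffices.\<close>
    define h where "h = (\<lambda>x::real. exp (- x / 2) / 2)"
    define H where "H = (\<lambda>x::real. exp (- x / 2))"
    have "h \<in> borel_measurable borel" unfolding h_def by measurable
    moreover have "(H \<longlongrightarrow> 0) at_top" unfolding H_def by real_asymp
    moreover have "(H has_real_derivative - h x) (at x)" for x
      unfolding H_def h_def by (auto intro!: derivative_eq_intros)
    moreover have "chi_sq_density p x \<le> h x" if "x \<ge> 1" for x
      using that by (simp add: 2 h_def chi_sq_density_def)
    moreover have "H x < 0.8 * (real p)\<^sup>2 * x powr (p / 2 - 1) * exp (- x / 2)" if "x \<ge> 1" for x
      using that by (simp add: 2 H_def)
    ultimately show ?thesis by blast
  next
    case 3
    then obtain H h where h[measurable]: "h \<in> borel_measurable borel" and H: "(H \<longlongrightarrow> 0) at_top"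
      and Hh: "\<And>x. x \<ge> 1 \<Longrightarrow> (H has_real_derivative - h x) (at x)"
        "\<And>x. x \<ge> 1 \<Longrightarrow> chi_sq_density q x \<le> h x"
        "\<And>x. x \<ge> 1 \<Longrightarrow> H x < 0.8 * (real q)\<^sup>2 * x powr (q / 2 - 1) * exp (- x / 2)"
      using less.IH[of q] by auto
    define a where "a = real q / 2"
    have a: "a > 0" using 3 by (simp add: a_def)
    have G: "Gamma a > 0" using a by (rule Gamma_real_pos)
    have G1: "Gamma (a + 1) = a * Gamma a"
      using a by (metis Gamma_plus1 nonpos_Ints_nonpos not_less)
    define K where "K = 1 / (2 powr a * Gamma (a + 1))"
    define g where "g = (\<lambda>x::real. K * (x powr a * exp (- x / 2)))"
    have p2: "real p / 2 = a + 1" using 3 by (simp add: a_def)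
    \<comment> \<open>Room for \<open>K\<close> is available: going from \<open>q\<close> to
      \<open>p = q + 2\<close> raises \<open>0.8 * q\<^sup>2\<close> by
      \<open>3.2 * (q + 1)\<close>.\<close>
    have K1: "K \<le> 2"
      using frac_le[OF _ _ _ one_le_two_powr_Gamma[of q], of 1 1] unfolding K_def a_def[symmetric]
      by linarith
    have "(\<lambda>x. h x + chi_sq_density p x - chi_sq_density q x) \<in> borel_measurable borel"
      by measurable
    moreover have "((\<lambda>x. H x + g x) \<longlongrightarrow> 0) at_top"
    proof -
      have "(g \<longlongrightarrow> 0) at_top" unfolding g_def using a by real_asymp
      from tendsto_add[OF H this] show ?thesis by simp
    qed
    moreover have "((\<lambda>x. H x + g x) has_real_derivative - (h x + chi_sq_density p x - chi_sq_density q x)) (at x)"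
      if "x \<ge> 1" for x
    proof -
      have "(g has_real_derivative K * (a * x powr (a - 1) * exp (- x / 2) - x powr a * exp (- x / 2) / 2)) (at x)"
        unfolding g_def using that by (auto intro!: derivative_eq_intros simp: field_simps)
      also have "K * (a * x powr (a - 1) * exp (- x / 2) - x powr a * exp (- x / 2) / 2)
         = chi_sq_density q x - chi_sq_density p x"
      proof -
        have alg: "1 / (W * (a * C)) * (a * y * E - z * E / 2) = y * E / (W * C) - z * E / (W * 2 * (a * C))"
          if "W \<noteq> 0" "C \<noteq> 0" for W C y z E :: real
          using a that by (simp add: field_simps)
        have "chi_sq_density q x = x powr (a - 1) * exp (- x / 2) / (2 powr a * Gamma a)"
          using \<open>1 \<le> x\<close> by (simp add: chi_sq_density_def flip: a_def)
        moreover have "chi_sq_density p x = x powr a * exp (- x / 2) / (2 powr a * 2 * (a * Gamma a))"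
          using \<open>1 \<le> x\<close> by (simp add: chi_sq_density_def p2 powr_add G1)
        ultimately show ?thesis
          unfolding K_def G1 using alg[of "2 powr a" "Gamma a"] G by simp
      qed
      finally have g': "(g has_real_derivative chi_sq_density q x - chi_sq_density p x) (at x)" .
      show ?thesis
        using DERIV_add[OF Hh(1)[OF that] g'] by (simp add: algebra_simps)
    qed
    moreover have "chi_sq_density p x \<le> h x + chi_sq_density p x - chi_sq_density q x" if "x \<ge> 1" for x
      using Hh(2)[OF that] by simp
    moreover have "H x + g x < 0.8 * (real p)\<^sup>2 * x powr (p / 2 - 1) * exp (- x / 2)" if "x \<ge> 1" for x
    proof -
      have "H x < 0.8 * (real q)\<^sup>2 * x powr (a - 1) * exp (- x / 2)"
        using Hh(3)[OF that] by (simp add: a_def)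
      \<comment> \<open>\<open>x \<ge> 1\<close> lets the exponent grow by 1, so that both summands
        carry the factor \<open>x powr a\<close>, where \<open>a = p / 2 - 1\<close>.\<close>
      also have "\<dots> \<le> 0.8 * (real q)\<^sup>2 * x powr a * exp (- x / 2)"
        using that by (intro mult_right_mono mult_left_mono powr_mono) auto
      finally have "H x + g x < (0.8 * (real q)\<^sup>2 + K) * (x powr a * exp (- x / 2))"
        by (simp add: g_def algebra_simps)
      also have "\<dots> \<le> (0.8 * (real p)\<^sup>2) * (x powr a * exp (- x / 2))"
        using K1 by (intro mult_right_mono) (auto simp: 3 power2_eq_square algebra_simps)
      finally show ?thesis by (simp add: p2 mult.assoc)
    qed
    ultimately show ?thesis by blast
  qed
qed

text \<open>Beyond \<open>t\<close> the density lies below \<open>h\<close>, whose integral there is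
  \<open>H t\<close> because \<open>H\<close> vanishes at infinity.\<close>

lemma chi_sq_tail:
  assumes p: "p > 0" and t: "t \<ge> 1"
  shows "measure (chi_sq p) {t..} < 0.8 * (real p)\<^sup>2 * t powr (p / 2 - 1) * exp (- t / 2)"
proof -
  obtain H h where h[measurable]: "h \<in> borel_measurable borel" and H: "(H \<longlongrightarrow> 0) at_top"
      and Hh: "\<And>x. x \<ge> 1 \<Longrightarrow> (H has_real_derivative - h x) (at x)"
        "\<And>x. x \<ge> 1 \<Longrightarrow> chi_sq_density p x \<le> h x"
        "\<And>x. x \<ge> 1 \<Longrightarrow> H x < 0.8 * (real p)\<^sup>2 * x powr (p / 2 - 1) * exp (- x / 2)"
    using chi_sq_tail_majorant[OF p] by auto
  have h0: "h x \<ge> 0" if "x \<ge> 1" for x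
    using Hh(2)[OF that] chi_sq_density_nonneg[of p x] by linarith
  have "emeasure (chi_sq p) {t..} = (\<integral>\<^sup>+x. ennreal (chi_sq_density p x) * indicator {t..} x \<partial>lborel)"
    by (simp add: chi_sq_def emeasure_density)
  also have "\<dots> \<le> (\<integral>\<^sup>+x. ennreal (h x) * indicator {t..} x \<partial>lborel)"
    using Hh(2) t by (intro nn_integral_mono) (auto simp: indicator_def intro!: ennreal_leI)
  also have "\<dots> = ennreal (0 - (- H t))"
  proof (rule nn_integral_FTC_atLeast)
    show "((\<lambda>x. - H x) has_real_derivative h x) (at x)" if "t \<le> x" for x
      using DERIV_minus[OF Hh(1)[of x]] that t by simp
    show "((\<lambda>x. - H x) \<longlongrightarrow> 0) at_top"
      using tendsto_minus[OF H] by simp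
  qed (use h0 t in auto)
  finally have "emeasure (chi_sq p) {t..} \<le> ennreal (H t)" by simp
  \<comment> \<open>\<open>ennreal\<close> truncates negative values, hence the maximum with 0;
    positivity of the target covers both alternatives.\<close>
  then have "measure (chi_sq p) {t..} \<le> max 0 (H t)"
    unfolding measure_def
    by (intro enn2real_leI order_trans[OF _ ennreal_leI[of "H t" "max 0 (H t)"]]) auto
  moreover have "0 < 0.8 * (real p)\<^sup>2 * t powr (p / 2 - 1) * exp (- t / 2)"
    using p t by simp
  ultimately show ?thesis
    using Hh(3)[OF t] by linarith
qed

subsection \<open>Projections of Gaussian noise onto orthonormal systems\<close>

lemma integral_iexp_normal:
  assumes "\<sigma> > 0"
  shows "(\<integral>x. iexp (u * x) \<partial>density lborel (normal_density 0 \<sigma>)) = of_real (exp (- (\<sigma> * u)\<^sup>2 / 2))"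
proof -
  interpret prob_space std_normal_distribution
    by (rule prob_space_normal_density) simp
  have "distributed std_normal_distribution lborel (\<lambda>x. x) std_normal_density"
    by (auto simp: distributed_def distr_id2)
  from normal_density_affine[OF this, of \<sigma> 0]
  have "density lborel (normal_density 0 \<sigma>) = distr std_normal_distribution lborel (\<lambda>x. \<sigma> * x)"
    using assms by (simp add: distributed_def)
  then have "(\<integral>x. iexp (u * x) \<partial>density lborel (normal_density 0 \<sigma>))
      = (\<integral>x. iexp (\<sigma> * u * x) \<partial>std_normal_distribution)"
    by (simp add: integral_distr mult_ac)
  also have "\<dots> = char std_normal_distribution (\<sigma> * u)"
    by (simp add: char_def)
  finally show ?thesis
    by (simp add: char_std_normal_distribution)
qed

text \<open>For \<open>\<tau>\<^sup>2 = 1 / (1 + 2 * s)\<close> the exponents add up to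
  \<open>x\<^sup>2 / (2 * \<tau>\<^sup>2)\<close>, so the integrand is \<open>\<tau>\<close> times
  the normal density with standard deviation \<open>\<tau>\<close>.\<close>

lemma integral_exp_square_normal:
  assumes "s \<ge> 0"
  shows "(\<integral>x. exp (- s * x\<^sup>2) \<partial>std_normal_distribution) = (1 + 2 * s) powr (- 1 / 2)"
proof -
  define \<tau> where "\<tau> = 1 / sqrt (1 + 2 * s)"
  have \<tau>: "\<tau> > 0" "\<tau>\<^sup>2 = 1 / (1 + 2 * s)" using assms by (auto simp: \<tau>_def power_divide)
  have "std_normal_density x * exp (- s * x\<^sup>2) = \<tau> * normal_density 0 \<tau> x" for x
  proof -
    have "\<tau> * (1 / sqrt (2 * pi * \<tau>\<^sup>2)) = 1 / sqrt (2 * pi)"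
      using \<tau>(1) by (simp add: real_sqrt_mult)
    moreover have "exp (- x\<^sup>2 / 2) * exp (- s * x\<^sup>2) = exp (- x\<^sup>2 / (2 * \<tau>\<^sup>2))"
      using assms by (simp add: \<tau> exp_add[symmetric] field_simps)
    moreover have "std_normal_density x * exp (- s * x\<^sup>2)
        = 1 / sqrt (2 * pi) * (exp (- x\<^sup>2 / 2) * exp (- s * x\<^sup>2))"
      by (simp add: normal_density_def)
    ultimately have "std_normal_density x * exp (- s * x\<^sup>2)
        = \<tau> * (1 / sqrt (2 * pi * \<tau>\<^sup>2)) * exp (- x\<^sup>2 / (2 * \<tau>\<^sup>2))"
      by (simp only:)
    then show ?thesis
      by (simp add: normal_density_def)
  qed
  then have "(\<integral>x. exp (- s * x\<^sup>2) \<partial>std_normal_distribution) = (\<integral>x. \<tau> * normal_density 0 \<tau> x \<partial>lborel)"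
    by (simp add: integral_density)
  also have "\<dots> = \<tau>"
    using \<tau> by simp
  also have "\<tau> = (1 + 2 * s) powr (- 1 / 2)"
    using assms by (simp add: \<tau>_def powr_half_sqrt powr_minus_divide)
  finally show ?thesis .
qed

lemma prob_space_gauss_noise: "\<sigma> > 0 \<Longrightarrow> prob_space (gauss_noise L \<sigma>)"
  unfolding gauss_noise_def by (intro prob_space_PiM prob_space_normal_density)

lemma product_sigma_finite_normal:
  "\<sigma> > 0 \<Longrightarrow> product_sigma_finite (\<lambda>_::nat. density lborel (normal_density 0 \<sigma>))"
  by (intro product_sigma_finite.intro prob_space_imp_sigma_finite prob_space_normal_density)

lemma measurable_gauss_noise_component:
  "l < L \<Longrightarrow> (\<lambda>w. w l) \<in> borel_measurable (gauss_noise L \<sigma>)"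
proof -
  assume "l < L"
  then have "(\<lambda>w. w l) \<in> measurable (gauss_noise L \<sigma>) (density lborel (normal_density 0 \<sigma>))"
    unfolding gauss_noise_def by (intro measurable_component_singleton) auto
  then show ?thesis by simp
qed

lemma borel_measurable_gauss_noise_linear:
  "(\<lambda>w. \<Sum>l<L. v l * w l) \<in> borel_measurable (gauss_noise L \<sigma>)"
  by (intro borel_measurable_sum borel_measurable_times measurable_gauss_noise_component) auto

lemma integral_iexp_gauss_noise:
  assumes "\<sigma> > 0"
  shows "(\<integral>w. iexp (\<Sum>l<L. v l * w l) \<partial>gauss_noise L \<sigma>)
    = of_real (exp (- \<sigma>\<^sup>2 * (\<Sum>l<L. (v l)\<^sup>2) / 2))"
proof -
  interpret product_sigma_finite "\<lambda>_::nat. density lborel (normal_density 0 \<sigma>)"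
    using assms by (rule product_sigma_finite_normal)
  interpret P: prob_space "density lborel (normal_density 0 \<sigma>)"
    using assms by (rule prob_space_normal_density)
  have "(\<integral>w. iexp (\<Sum>l<L. v l * w l) \<partial>gauss_noise L \<sigma>)
     = (\<integral>w. (\<Prod>l<L. iexp (v l * w l)) \<partial>gauss_noise L \<sigma>)"
    by (simp add: exp_sum sum_distrib_left)
  also have "\<dots> = (\<Prod>l<L. \<integral>x. iexp (v l * x) \<partial>density lborel (normal_density 0 \<sigma>))"
    unfolding gauss_noise_def
    by (rule product_integral_prod) (auto intro!: P.integrable_const_bound[where B = 1])
  also have "\<dots> = (\<Prod>l<L. of_real (exp (- (\<sigma> * v l)\<^sup>2 / 2)))"
    using assms by (simp only: integral_iexp_normal)
  also have "\<dots> = of_real (exp (- \<sigma>\<^sup>2 * (\<Sum>l<L. (v l)\<^sup>2) / 2))"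
    by (simp add: exp_sum[symmetric] sum_distrib_left sum_divide_distrib power_mult_distrib sum_negf flip: of_real_prod)
  finally show ?thesis .
qed

lemma integral_exp_sum_square_gauss_noise:
  assumes "s \<ge> 0"
  shows "(\<integral>g. exp (- s * (\<Sum>b<p. (g b)\<^sup>2)) \<partial>gauss_noise p 1) = (1 + 2 * s) powr (- (p / 2))"
proof -
  interpret product_sigma_finite "\<lambda>_::nat. density lborel (normal_density 0 1)"
    by (rule product_sigma_finite_normal) simp
  interpret P: prob_space "density lborel (normal_density 0 1)"
    by (rule prob_space_normal_density) simp
  have "(\<integral>g. exp (- s * (\<Sum>b<p. (g b)\<^sup>2)) \<partial>gauss_noise p 1)
     = (\<integral>g. (\<Prod>b<p. exp (- s * (g b)\<^sup>2)) \<partial>gauss_noise p 1)"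
    by (simp add: exp_sum sum_distrib_left flip: sum_negf)
  also have "\<dots> = (\<Prod>b<p. \<integral>x. exp (- s * x\<^sup>2) \<partial>density lborel (normal_density 0 1))"
    unfolding gauss_noise_def
    by (rule product_integral_prod) (use assms in \<open>auto intro!: P.integrable_const_bound[where B = 1]\<close>)
  also have "\<dots> = ((1 + 2 * s) powr (- 1 / 2)) ^ p"
    using integral_exp_square_normal[OF assms] by simp
  also have "\<dots> = (1 + 2 * s) powr (- (p / 2))"
    using assms by (simp add: powr_power)
  finally show ?thesis .
qed

definition orthonormal :: "nat \<Rightarrow> nat \<Rightarrow> (nat \<Rightarrow> nat \<Rightarrow> real) \<Rightarrow> bool" where
  "orthonormal L p q \<longleftrightarrow> (\<forall>a<p. \<forall>b<p. (\<Sum>l<L. q a l * q b l) = (if a = b then 1 else 0))"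

lemma orthonormal_sum_square:
  assumes "orthonormal L p q"
  shows "(\<Sum>l<L. (\<Sum>b<p. g b * q b l)\<^sup>2) = (\<Sum>b<p. (g b)\<^sup>2)"
proof -
  have "(\<Sum>l<L. (\<Sum>b<p. g b * q b l)\<^sup>2) = (\<Sum>l<L. \<Sum>a<p. \<Sum>b<p. g a * g b * (q a l * q b l))"
    by (simp add: power2_eq_square sum_product mult_ac)
  also have "\<dots> = (\<Sum>a<p. \<Sum>l<L. \<Sum>b<p. g a * g b * (q a l * q b l))"
    by (rule sum.swap)
  also have "\<dots> = (\<Sum>a<p. \<Sum>b<p. \<Sum>l<L. g a * g b * (q a l * q b l))"
    by (intro sum.cong refl sum.swap)
  also have "\<dots> = (\<Sum>a<p. \<Sum>b<p. g a * g b * (\<Sum>l<L. q a l * q b l))"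
    by (simp add: sum_distrib_left)
  also have "\<dots> = (\<Sum>a<p. \<Sum>b<p. g a * g b * (if a = b then 1 else 0))"
    using assms by (intro sum.cong refl) (auto simp: orthonormal_def)
  also have "\<dots> = (\<Sum>b<p. (g b)\<^sup>2)"
    by (simp add: power2_eq_square mult_delta_right)
  finally show ?thesis .
qed

text \<open>The square is linearised by an independent standard Gaussian \<open>g\<close>, since
  \<open>exp (- s z\<^sup>2)\<close> is the expectation of \<open>exp (\<i> sqrt (2 s) g z)\<close>; after exchanging the
  two expectations, orthonormality turns the result into the Laplace transform of the squared length
  of \<open>g\<close>.\<close>

lemma laplace_orthonormal_gauss_noise:
  assumes q: "orthonormal L p q" and s: "s \<ge> 0" and \<sigma>: "\<sigma> > 0"
  shows "(\<integral>w. exp (- s * (\<Sum>b<p. (\<Sum>l<L. q b l * w l)\<^sup>2)) \<partial>gauss_noise L \<sigma>)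
      = (1 + 2 * (s * \<sigma>\<^sup>2)) powr (- (p / 2))"
proof -
  define c where "c = sqrt (2 * s)"
  define Z where "Z = (\<lambda>b w. \<Sum>l<L. q b l * w l)"
  interpret G: prob_space "gauss_noise p 1" by (rule prob_space_gauss_noise) simp
  interpret W: prob_space "gauss_noise L \<sigma>" using \<sigma> by (rule prob_space_gauss_noise)
  interpret GW: pair_prob_space "gauss_noise p 1" "gauss_noise L \<sigma>" ..
  have c2: "c\<^sup>2 = 2 * s" using s by (simp add: c_def)
  have "Z b \<in> borel_measurable (gauss_noise L \<sigma>)" for b
    unfolding Z_def by (rule borel_measurable_gauss_noise_linear)
  from measurable_compose[OF measurable_snd this]
  have Zm: "(\<lambda>x. Z b (snd x)) \<in> borel_measurable (gauss_noise p 1 \<Otimes>\<^sub>M gauss_noise L \<sigma>)" for b .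
  have meas: "(\<lambda>(g, w). \<Sum>b<p. c * Z b w * g b) \<in> borel_measurable (gauss_noise p 1 \<Otimes>\<^sub>M gauss_noise L \<sigma>)"
    unfolding case_prod_beta'
    by (intro borel_measurable_sum borel_measurable_times borel_measurable_const Zm
        measurable_compose[OF measurable_fst measurable_gauss_noise_component]) auto
  have "(\<lambda>x. iexp x) \<in> borel_measurable borel"
    by measurable
  from measurable_compose[OF meas this]
  have meas': "(\<lambda>(g, w). iexp (\<Sum>b<p. c * Z b w * g b)) \<in> borel_measurable (gauss_noise p 1 \<Otimes>\<^sub>M gauss_noise L \<sigma>)"
    by (simp only: case_prod_beta')
  have "complex_of_real (\<integral>w. exp (- s * (\<Sum>b<p. (Z b w)\<^sup>2)) \<partial>gauss_noise L \<sigma>)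
      = (\<integral>w. of_real (exp (- 1\<^sup>2 * (\<Sum>b<p. (c * Z b w)\<^sup>2) / 2)) \<partial>gauss_noise L \<sigma>)"
    by (simp add: power_mult_distrib c2 flip: sum_distrib_left)
  also have "\<dots> = (\<integral>w. (\<integral>g. iexp (\<Sum>b<p. c * Z b w * g b) \<partial>gauss_noise p 1) \<partial>gauss_noise L \<sigma>)"
    by (subst integral_iexp_gauss_noise) auto
  also have "\<dots> = (\<integral>g. (\<integral>w. iexp (\<Sum>b<p. c * Z b w * g b) \<partial>gauss_noise L \<sigma>) \<partial>gauss_noise p 1)"
    by (rule GW.Fubini_integral)
       (use meas' in \<open>auto intro!: GW.P.integrable_const_bound[where B = 1] simp: case_prod_beta'\<close>)
  \<comment> \<open>Collecting the exponent by the coordinates of \<open>w\<close> makes the inner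
    integral a characteristic function again, now at the frequencies
    \<open>c * (\<Sum>b<p. g b * q b l)\<close>.\<close>
  also have "\<dots> = (\<integral>g. (\<integral>w. iexp (\<Sum>l<L. (c * (\<Sum>b<p. g b * q b l)) * w l) \<partial>gauss_noise L \<sigma>) \<partial>gauss_noise p 1)"
  proof -
    have "(\<Sum>b<p. c * Z b w * g b) = (\<Sum>l<L. (c * (\<Sum>b<p. g b * q b l)) * w l)" for g w
      unfolding Z_def sum_distrib_left sum_distrib_right
      by (subst sum.swap) (simp add: mult_ac)
    then show ?thesis by simp
  qed
  also have "\<dots> = (\<integral>g. of_real (exp (- \<sigma>\<^sup>2 * (\<Sum>l<L. (c * (\<Sum>b<p. g b * q b l))\<^sup>2) / 2)) \<partial>gauss_noise p 1)"
    using \<sigma> by (subst integral_iexp_gauss_noise) auto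
  also have "\<dots> = of_real (\<integral>g. exp (- (s * \<sigma>\<^sup>2) * (\<Sum>b<p. (g b)\<^sup>2)) \<partial>gauss_noise p 1)"
    by (simp add: power_mult_distrib c2 orthonormal_sum_square[OF q] mult_ac flip: sum_distrib_left)
  also have "\<dots> = of_real ((1 + 2 * (s * \<sigma>\<^sup>2)) powr (- (p / 2)))"
    using s by (subst integral_exp_sum_square_gauss_noise) auto
  finally show ?thesis
    unfolding Z_def of_real_eq_iff .
qed

text \<open>The moments of \<open>exp (- X)\<close> are Laplace transforms of \<open>X\<close> at
  natural numbers and agree with those of \<open>chi_sq p\<close>. Since \<open>exp\<close> is
  monotone, \<open>X \<ge> t\<close> is the event \<open>exp (- X) \<le> exp (- t)\<close> of a
  variable in the unit interval.\<close>

lemma prob_orthonormal_gauss_noise: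
  assumes q: "orthonormal L p q" and p: "p > 0" and \<sigma>: "\<sigma> > 0" and t: "t \<ge> 1"
  shows "measure (gauss_noise L \<sigma>) {w \<in> space (gauss_noise L \<sigma>). (\<Sum>b<p. (\<Sum>l<L. q b l * w l)\<^sup>2) \<ge> \<sigma>\<^sup>2 * t}
      < 0.8 * (real p)\<^sup>2 * t powr (p / 2 - 1) * exp (- t / 2)"
proof -
  define X where "X = (\<lambda>w. (\<Sum>b<p. (\<Sum>l<L. q b l * w l)\<^sup>2) / \<sigma>\<^sup>2)"
  have [measurable]: "X \<in> borel_measurable (gauss_noise L \<sigma>)"
    unfolding X_def
    by (intro borel_measurable_divide borel_measurable_sum borel_measurable_power
        borel_measurable_gauss_noise_linear borel_measurable_const)
  have X0: "X w \<ge> 0" for w unfolding X_def by (intro divide_nonneg_nonneg sum_nonneg) auto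
  have Xt: "X w \<ge> t \<longleftrightarrow> (\<Sum>b<p. (\<Sum>l<L. q b l * w l)\<^sup>2) \<ge> \<sigma>\<^sup>2 * t" for w
    using \<sigma> by (simp add: X_def pos_le_divide_eq mult.commute)
  \<comment> \<open>The truncation keeps \<open>V\<close> in the unit interval at every real;
    \<open>chi_sq p\<close> gives no mass to negative numbers.\<close>
  define V where "V = (\<lambda>x::real. exp (- max 0 x))"
  have "measure (gauss_noise L \<sigma>) {w \<in> space (gauss_noise L \<sigma>). exp (- X w) \<le> exp (- t)}
     = measure (chi_sq p) {x \<in> space (chi_sq p). V x \<le> exp (- t)}"
  proof (rule prob_le_eq_of_moments)
    show "prob_space (gauss_noise L \<sigma>)" "prob_space (chi_sq p)"
      using prob_space_gauss_noise[OF \<sigma>] prob_space_chi_sq[OF p] by auto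
    show "(\<lambda>w. exp (- X w)) \<in> borel_measurable (gauss_noise L \<sigma>)" by measurable
    show "V \<in> borel_measurable (chi_sq p)" unfolding V_def chi_sq_def by measurable
    show "exp (- X w) \<in> {0..1}" for w using X0[of w] by simp
    show "V x \<in> {0..1}" for x by (simp add: V_def)
    fix n :: nat
    have "(\<integral>w. exp (- X w) ^ n \<partial>gauss_noise L \<sigma>)
       = (\<integral>w. exp (- (n / \<sigma>\<^sup>2) * (\<Sum>b<p. (\<Sum>l<L. q b l * w l)\<^sup>2)) \<partial>gauss_noise L \<sigma>)"
      by (simp add: X_def flip: exp_of_nat_mult)
    \<comment> \<open>The Laplace transform at \<open>s = n / \<sigma>\<^sup>2\<close>, for which
      \<open>s * \<sigma>\<^sup>2 = n\<close>.\<close>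
    also have "\<dots> = (1 + 2 * real n) powr (- (p / 2))"
      using \<sigma> by (subst laplace_orthonormal_gauss_noise[OF q]) auto
    also have "\<dots> = (\<integral>x. exp (- real n * x) \<partial>chi_sq p)"
      using chi_sq_laplace[OF p, of "real n"] by simp
    also have "\<dots> = (\<integral>x. V x ^ n \<partial>chi_sq p)"
    proof (rule integral_cong_AE)
      show "AE x in chi_sq p. exp (- real n * x) = V x ^ n"
        unfolding chi_sq_def
        by (subst AE_density) (auto simp: V_def chi_sq_density_def indicator_def max_def simp flip: exp_of_nat_mult split: if_splits)
    qed (auto simp: chi_sq_def V_def)
    finally show "(\<integral>w. exp (- X w) ^ n \<partial>gauss_noise L \<sigma>) = (\<integral>x. V x ^ n \<partial>chi_sq p)" .
  qed
  also have "{x \<in> space (chi_sq p). V x \<le> exp (- t)} = {t..}"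
    using t by (auto simp: V_def chi_sq_def)
  finally show ?thesis
    using chi_sq_tail[OF p t] by (simp add: Xt)
qed

subsection \<open>Block dictionaries\<close>

text \<open>The \<open>v a\<close> may be linearly dependent, so a direction is added only when the
  residual of \<open>v n\<close> is nonzero; hence \<open>p \<le> n\<close> instead of
  equality.\<close>

lemma gram_schmidt:
  fixes v :: "nat \<Rightarrow> nat \<Rightarrow> real"
  shows "\<exists>p\<le>n. \<exists>q c. orthonormal L p q \<and> (\<forall>a<n. \<forall>l<L. v a l = (\<Sum>b<p. c a b * q b l))"
proof (induction n)
  case 0
  show ?case by (auto simp: orthonormal_def)
next
  case (Suc n)
  then obtain p q c where p: "p \<le> n" and q: "orthonormal L p q"
    and c: "\<And>a l. a < n \<Longrightarrow> l < L \<Longrightarrow> v a l = (\<Sum>b<p. c a b * q b l)"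
    by blast
  define k where "k = (\<lambda>b. \<Sum>l<L. v n l * q b l)"
  define r where "r = (\<lambda>l. v n l - (\<Sum>b<p. k b * q b l))"
  define R where "R = (\<Sum>l<L. (r l)\<^sup>2)"
  show ?case
  proof (cases "R = 0")
    case True
    then have "r l = 0" if "l < L" for l
      using that by (auto simp: R_def sum_nonneg_eq_0_iff)
    then have "v n l = (\<Sum>b<p. k b * q b l)" if "l < L" for l
      using that by (simp add: r_def)
    then have "\<forall>a<Suc n. \<forall>l<L. v a l = (\<Sum>b<p. (c(n := k)) a b * q b l)"
      using c by (auto simp: less_Suc_eq)
    then show ?thesis
      using p q by (intro exI[of _ p] conjI exI[of _ q] exI[of _ "c(n := k)"]) auto
  next
    case False
    then have R: "R > 0"
      unfolding R_def by (metis sum_nonneg zero_le_power2 order_le_less)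
    have rq: "(\<Sum>l<L. r l * q a l) = 0" if "a < p" for a
    proof -
      have "(\<Sum>l<L. r l * q a l) = k a - (\<Sum>l<L. \<Sum>b<p. k b * (q b l * q a l))"
        by (simp add: r_def k_def left_diff_distrib sum_subtractf sum_distrib_right mult.assoc)
      also have "(\<Sum>l<L. \<Sum>b<p. k b * (q b l * q a l)) = (\<Sum>b<p. k b * (\<Sum>l<L. q b l * q a l))"
        by (subst sum.swap) (simp add: sum_distrib_left)
      also have "\<dots> = (\<Sum>b<p. k b * (if b = a then 1 else 0))"
        using q that by (intro sum.cong refl) (auto simp: orthonormal_def)
      also have "\<dots> = k a"
        using that by (simp add: mult_delta_right)
      finally show ?thesis by simp
    qed
    define q' where "q' = q(p := (\<lambda>l. r l / sqrt R))"
    \<comment> \<open>\<open>v n\<close> is its projection plus \<open>sqrt R\<close> times the new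
      unit vector; earlier vectors have coefficient 0 in that direction.\<close>
    define c' where "c' = (\<lambda>a b. if a = n then (if b = p then sqrt R else k b) else (if b = p then 0 else c a b))"
    have "orthonormal L (Suc p) q'"
      unfolding orthonormal_def
    proof (intro allI impI)
      fix a b assume ab: "a < Suc p" "b < Suc p"
      have pp: "(\<Sum>l<L. r l / sqrt R * (r l / sqrt R)) = 1"
      proof -
        have "(\<Sum>l<L. r l / sqrt R * (r l / sqrt R)) = (\<Sum>l<L. (r l)\<^sup>2) / R"
          using R by (simp add: power2_eq_square sum_divide_distrib)
        then show ?thesis using R by (simp flip: R_def)
      qed
      have pa: "(\<Sum>l<L. r l / sqrt R * q a l) = 0" if "a < p" for a
        using rq[OF that] by (simp flip: sum_divide_distrib)
      have ap: "(\<Sum>l<L. q a l * (r l / sqrt R)) = 0" if "a < p" for a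
        using pa[OF that] by (simp add: mult.commute)
      show "(\<Sum>l<L. q' a l * q' b l) = (if a = b then 1 else 0)"
        using ab q pp pa ap by (auto simp: q'_def orthonormal_def less_Suc_eq)
    qed
    moreover have "v a l = (\<Sum>b<Suc p. c' a b * q' b l)" if "a < Suc n" "l < L" for a l
    proof -
      have "(\<Sum>b<p. c' a b * q' b l) = (\<Sum>b<p. (if a = n then k b else c a b) * q b l)"
        by (intro sum.cong) (auto simp: c'_def q'_def)
      then show ?thesis
        using c[of a l] that R by (auto simp: c'_def q'_def r_def)
    qed
    ultimately show ?thesis
      using p by (intro exI[of _ "Suc p"] conjI exI[of _ q'] exI[of _ c']) auto
  qed
qed

text \<open>Cauchy-Schwarz bounds the full double sum by \<open>card I\<close> times the sum of
  squares, and the diagonal takes off one copy. It serves for the entries of one block and again for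
  the blocks of a selected set.\<close>

lemma sum_off_diagonal_le:
  fixes f :: "'a \<Rightarrow> real"
  assumes "finite I"
  shows "(\<Sum>a\<in>I. \<Sum>b\<in>I - {a}. \<bar>f a\<bar> * \<bar>f b\<bar>) \<le> (real (card I) - 1) * (\<Sum>a\<in>I. (f a)\<^sup>2)"
proof -
  have "(\<Sum>a\<in>I. \<Sum>b\<in>I. \<bar>f a\<bar> * \<bar>f b\<bar>) = (\<Sum>a\<in>I. (f a)\<^sup>2 + (\<Sum>b\<in>I - {a}. \<bar>f a\<bar> * \<bar>f b\<bar>))"
    using assms by (intro sum.cong refl) (simp add: sum.remove power2_eq_square)
  moreover have "(\<Sum>a\<in>I. \<Sum>b\<in>I. \<bar>f a\<bar> * \<bar>f b\<bar>) \<le> real (card I) * (\<Sum>a\<in>I. (f a)\<^sup>2)"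
    using sum_squared_le_sum_of_squares[of "\<lambda>a. \<bar>f a\<bar>" I]
    by (simp add: power2_eq_square sum_product mult.commute)
  ultimately show ?thesis
    by (simp add: sum.distrib algebra_simps)
qed

lemma L2_set_power2: "(L2_set f A)\<^sup>2 = (\<Sum>a\<in>A. (f a)\<^sup>2)"
  by (simp add: L2_set_def sum_nonneg)

lemma sum_mult_le_L2_set: "(\<Sum>a\<in>A. f a * g a) \<le> L2_set f A * L2_set g A"
proof -
  have "(\<Sum>a\<in>A. f a * g a) \<le> (\<Sum>a\<in>A. \<bar>f a\<bar> * \<bar>g a\<bar>)"
    by (intro sum_mono) (simp flip: abs_mult)
  then show ?thesis using L2_set_mult_ineq[of f g A] by linarith
qed

lemma L2_set_sum_le: "L2_set (\<lambda>a. \<Sum>j\<in>I. f j a) A \<le> (\<Sum>j\<in>I. L2_set (f j) A)"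
proof (induction I rule: infinite_finite_induct)
  case (insert j I)
  then show ?case
    using L2_set_triangle_ineq[of "f j" "\<lambda>a. \<Sum>j\<in>I. f j a" A] by simp
qed (simp_all add: L2_set_def)

lemma L2_set_uminus: "L2_set (\<lambda>a. - f a) A = L2_set f A"
  by (simp add: L2_set_def)

lemma L2_set_diff_ge: "L2_set f A - L2_set g A \<le> L2_set (\<lambda>a. f a + g a) A"
  using L2_set_triangle_ineq[of "\<lambda>a. f a + g a" "\<lambda>a. - g a" A] by (simp add: L2_set_uminus)

lemma L2_set_mat_le_spec_norm:
  "L2_set (\<lambda>r. \<Sum>c<n. A r c * u c) {..<m} \<le> spec_norm m n A * L2_set u {..<n}"
proof -
  let ?S = "{sqrt (\<Sum>r<m. (\<Sum>c<n. A r c * u c)\<^sup>2) | u. (\<Sum>c<n. (u c)\<^sup>2) \<le> 1}"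
  \<comment> \<open>\<open>Sup\<close> dominates its set only if the set is bounded. Entries of a
    vector in the unit ball are at most 1 in modulus, so absolute row sums give a bound.\<close>
  have bdd: "bdd_above ?S"
  proof (rule bdd_aboveI)
    fix y assume "y \<in> ?S"
    then obtain u where u: "(\<Sum>c<n. (u c)\<^sup>2) \<le> 1" and y: "y = sqrt (\<Sum>r<m. (\<Sum>c<n. A r c * u c)\<^sup>2)"
      by auto
    have u1: "\<bar>u c\<bar> \<le> 1" if "c < n" for c
    proof -
      have "(u c)\<^sup>2 \<le> (\<Sum>c<n. (u c)\<^sup>2)"
        using that by (intro member_le_sum) auto
      with u have "(u c)\<^sup>2 \<le> 1" by linarith
      then show ?thesis by (simp add: abs_square_le_1)
    qed
    have "\<bar>\<Sum>c<n. A r c * u c\<bar> \<le> (\<Sum>c<n. \<bar>A r c\<bar>)" for r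
      by (rule order_trans[OF sum_abs sum_mono]) (simp add: abs_mult mult_left_le u1)
    then have "(\<Sum>c<n. A r c * u c)\<^sup>2 \<le> (\<Sum>c<n. \<bar>A r c\<bar>)\<^sup>2" for r
      by (metis abs_ge_zero power2_abs power_mono)
    then show "y \<le> sqrt (\<Sum>r<m. (\<Sum>c<n. \<bar>A r c\<bar>)\<^sup>2)"
      unfolding y by (intro real_sqrt_le_mono sum_mono)
  qed
  show ?thesis
  proof (cases "L2_set u {..<n} = 0")
    case True
    then have "u c = 0" if "c < n" for c
      using that by (simp add: L2_set_eq_0_iff)
    then have "(\<Sum>c<n. A r c * u c) = 0" for r by simp
    with True show ?thesis by (simp add: L2_set_def)
  next
    case False
    define N where "N = L2_set u {..<n}"
    have N: "N > 0" using False by (simp add: N_def less_le)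
    have "(\<Sum>c<n. (u c / N)\<^sup>2) = 1"
      using N L2_set_power2[of u "{..<n}", folded N_def]
      by (simp add: power_divide flip: sum_divide_distrib) (simp flip: \<open>N\<^sup>2 = _\<close>)
    then have "sqrt (\<Sum>r<m. (\<Sum>c<n. A r c * (u c / N))\<^sup>2) \<le> spec_norm m n A"
      unfolding spec_norm_def by (intro cSup_upper bdd) (auto intro!: exI[of _ "\<lambda>c. u c / N"])
    moreover have "sqrt (\<Sum>r<m. (\<Sum>c<n. A r c * (u c / N))\<^sup>2) = L2_set (\<lambda>r. \<Sum>c<n. A r c * u c) {..<m} / N"
      using N by (simp add: L2_set_def power_divide real_sqrt_divide flip: sum_divide_distrib)
    ultimately show ?thesis
      using N by (simp add: pos_divide_le_eq flip: N_def)
  qed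
qed

section \<open>Coherence bounds and the tail of the noise correlation of a block\<close>

locale block_dictionary =
  fixes L M d :: nat and D :: "nat \<Rightarrow> nat \<Rightarrow> real"
  assumes unit_cols: "j < M * d \<Longrightarrow> (\<Sum>l<L. (D l j)\<^sup>2) = 1"
    and d_pos: "d > 0"
begin

abbreviation "\<mu> \<equiv> block_coherence L M d D"
abbreviation "\<nu> \<equiv> sub_coherence L M d D"

abbreviation "gram \<equiv> block_gram L d D"

lemma index_less: "i < M \<Longrightarrow> a < d \<Longrightarrow> i * d + a < M * d"
  using mult_le_mono1[of "Suc i" M d] by simp

lemma sub_coherence_bounds:
  shows "0 \<le> \<nu>"
    and "i < M \<Longrightarrow> a < d \<Longrightarrow> b < d \<Longrightarrow> a \<noteq> b \<Longrightarrow> \<bar>gram i i a b\<bar> \<le> \<nu>"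
proof -
  let ?S = "{\<bar>\<Sum>l<L. D l (i * d + a) * D l (i * d + b)\<bar> | i a b. i < M \<and> a < d \<and> b < d \<and> a \<noteq> b}"
  have "?S \<subseteq> (\<lambda>(i, a, b). \<bar>\<Sum>l<L. D l (i * d + a) * D l (i * d + b)\<bar>) ` ({..<M} \<times> {..<d} \<times> {..<d})"
    by force
  then have fin: "finite ?S"
    by (rule finite_subset) auto
  show "0 \<le> \<nu>"
    unfolding sub_coherence_def by (rule Max_ge) (use fin in auto)
  show "\<bar>gram i i a b\<bar> \<le> \<nu>" if "i < M" "a < d" "b < d" "a \<noteq> b"
    unfolding sub_coherence_def block_gram_def by (rule Max_ge) (use fin that in auto)
qed

lemma block_coherence_bounds:
  shows "0 \<le> \<mu>"
    and "i < M \<Longrightarrow> j < M \<Longrightarrow> i \<noteq> j \<Longrightarrow> spec_norm d d (gram i j) \<le> d * \<mu>"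
proof -
  let ?S = "{spec_norm d d (gram i j) / real d | i j. i < M \<and> j < M \<and> i \<noteq> j}"
  have "?S \<subseteq> (\<lambda>(i, j). spec_norm d d (gram i j) / real d) ` ({..<M} \<times> {..<M})"
    by force
  then have fin: "finite ?S"
    by (rule finite_subset) auto
  show "0 \<le> \<mu>"
    unfolding block_coherence_def by (rule Max_ge) (use fin in auto)
  show "spec_norm d d (gram i j) \<le> d * \<mu>" if "i < M" "j < M" "i \<noteq> j"
  proof -
    have "spec_norm d d (gram i j) / real d \<le> \<mu>"
      unfolding block_coherence_def by (rule Max_ge) (use fin that in auto)
    then show ?thesis using d_pos by (simp add: divide_le_eq mult.commute)
  qed
qed

text \<open>Diagonal dominance: the diagonal is 1 and the other entries are at most
  \<open>\<nu>\<close> in modulus. The upper side is used for the noise, the lower side for the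
  signal.\<close>

lemma gram_quadratic_bound:
  assumes i: "i < M"
  shows "\<bar>(\<Sum>a<d. \<Sum>b<d. u a * u b * gram i i a b) - (\<Sum>a<d. (u a)\<^sup>2)\<bar> \<le> (real d - 1) * \<nu> * (\<Sum>a<d. (u a)\<^sup>2)"
proof -
  have "gram i i a a = 1" if "a < d" for a
    using unit_cols[OF index_less[OF i that]] by (simp add: block_gram_def power2_eq_square)
  then have "(\<Sum>b<d. u a * u b * gram i i a b) = (u a)\<^sup>2 + (\<Sum>b\<in>{..<d} - {a}. u a * u b * gram i i a b)"
    if "a < d" for a
    using that by (subst sum.remove[of _ a]) (auto simp: power2_eq_square)
  then have "(\<Sum>a<d. \<Sum>b<d. u a * u b * gram i i a b)
     = (\<Sum>a<d. (u a)\<^sup>2 + (\<Sum>b\<in>{..<d} - {a}. u a * u b * gram i i a b))"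
    by (intro sum.cong) auto
  then have "\<bar>(\<Sum>a<d. \<Sum>b<d. u a * u b * gram i i a b) - (\<Sum>a<d. (u a)\<^sup>2)\<bar>
     = \<bar>\<Sum>a<d. \<Sum>b\<in>{..<d} - {a}. u a * u b * gram i i a b\<bar>"
    by (simp add: sum.distrib)
  also have "\<dots> \<le> (\<Sum>a<d. \<Sum>b\<in>{..<d} - {a}. \<bar>u a\<bar> * \<bar>u b\<bar> * \<nu>)"
    using i by (intro order_trans[OF sum_abs] sum_mono order_trans[OF sum_abs])
      (auto simp: abs_mult intro!: mult_left_mono sub_coherence_bounds)
  also have "\<dots> = \<nu> * (\<Sum>a<d. \<Sum>b\<in>{..<d} - {a}. \<bar>u a\<bar> * \<bar>u b\<bar>)"
    by (simp add: sum_distrib_left mult.commute)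
  also have "\<dots> \<le> \<nu> * ((real (card {..<d}) - 1) * (\<Sum>a<d. (u a)\<^sup>2))"
    by (intro mult_left_mono sum_off_diagonal_le sub_coherence_bounds) auto
  finally show ?thesis by (simp add: mult_ac)
qed

lemma synthesis_sum_square:
  "(\<Sum>l<L. (\<Sum>a<d. u a * D l (i * d + a))\<^sup>2) = (\<Sum>a<d. \<Sum>b<d. u a * u b * gram i i a b)"
proof -
  have "(\<Sum>l<L. (\<Sum>a<d. u a * D l (i * d + a))\<^sup>2)
     = (\<Sum>l<L. \<Sum>a<d. \<Sum>b<d. u a * u b * (D l (i * d + a) * D l (i * d + b)))"
    by (simp add: power2_eq_square sum_product mult_ac)
  also have "\<dots> = (\<Sum>a<d. \<Sum>l<L. \<Sum>b<d. u a * u b * (D l (i * d + a) * D l (i * d + b)))"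
    by (rule sum.swap)
  also have "\<dots> = (\<Sum>a<d. \<Sum>b<d. \<Sum>l<L. u a * u b * (D l (i * d + a) * D l (i * d + b)))"
    by (intro sum.cong refl sum.swap)
  finally show ?thesis
    by (simp add: block_gram_def sum_distrib_left)
qed

text \<open>In the notation of the proof \<open>Y = (\<Sum>b<p. h b * Z b)\<close>, where
  \<open>h\<close> holds the coordinates in \<open>q\<close> of the columns combined with weights
  \<open>y\<close>. Cauchy-Schwarz applies, the Gram bound controls the squared length of
  \<open>h\<close> by a multiple of \<open>Y\<close>, and one factor \<open>Y\<close>
  cancels.\<close>

lemma block_corr_le_orthonormal:
  assumes i: "i < M" and q: "orthonormal L p q"
    and c: "\<And>a l. a < d \<Longrightarrow> l < L \<Longrightarrow> D l (i * d + a) = (\<Sum>b<p. c a b * q b l)"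
  shows "(block_corr L d D w i)\<^sup>2 \<le> (1 + (real d - 1) * \<nu>) * (\<Sum>b<p. (\<Sum>l<L. q b l * w l)\<^sup>2)"
proof -
  define y where "y = (\<lambda>a. \<Sum>l<L. D l (i * d + a) * w l)"
  define Z where "Z = (\<lambda>b. \<Sum>l<L. q b l * w l)"
  define h where "h = (\<lambda>b. \<Sum>a<d. y a * c a b)"
  define Y where "Y = (\<Sum>a<d. (y a)\<^sup>2)"
  have Y0: "Y \<ge> 0" by (simp add: Y_def sum_nonneg)
  have lam: "1 + (real d - 1) * \<nu> \<ge> 0"
    using d_pos sub_coherence_bounds(1) by (intro add_nonneg_nonneg mult_nonneg_nonneg) auto
  have yc: "y a = (\<Sum>b<p. c a b * Z b)" if "a < d" for a
  proof -
    have "y a = (\<Sum>l<L. \<Sum>b<p. c a b * (q b l * w l))"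
      using that by (simp add: y_def c sum_distrib_right mult.assoc)
    also have "\<dots> = (\<Sum>b<p. c a b * Z b)"
      by (subst sum.swap) (simp add: Z_def sum_distrib_left)
    finally show ?thesis .
  qed
  have "Y = (\<Sum>a<d. \<Sum>b<p. y a * c a b * Z b)"
    unfolding Y_def power2_eq_square
    by (intro sum.cong refl, subst (2) yc) (auto simp: sum_distrib_left mult.assoc)
  also have "\<dots> = (\<Sum>b<p. h b * Z b)"
    by (subst sum.swap) (simp add: h_def sum_distrib_right)
  finally have "Y\<^sup>2 \<le> (\<Sum>b<p. (h b)\<^sup>2) * (\<Sum>b<p. (Z b)\<^sup>2)"
    by (simp add: Cauchy_Schwarz_ineq_sum)
  also have "(\<Sum>b<p. (h b)\<^sup>2) = (\<Sum>l<L. (\<Sum>b<p. h b * q b l)\<^sup>2)"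
    by (rule orthonormal_sum_square[OF q, symmetric])
  also have "\<dots> = (\<Sum>l<L. (\<Sum>a<d. y a * D l (i * d + a))\<^sup>2)"
  proof (rule sum.cong[OF refl])
    fix l assume "l \<in> {..<L}"
    then have "(\<Sum>a<d. y a * D l (i * d + a)) = (\<Sum>a<d. \<Sum>b<p. y a * c a b * q b l)"
      by (simp add: c sum_distrib_left mult.assoc)
    also have "\<dots> = (\<Sum>b<p. h b * q b l)"
      by (subst sum.swap) (simp add: h_def sum_distrib_right)
    finally show "(\<Sum>b<p. h b * q b l)\<^sup>2 = (\<Sum>a<d. y a * D l (i * d + a))\<^sup>2" by simp
  qed
  also have "\<dots> \<le> (1 + (real d - 1) * \<nu>) * Y"
    using gram_quadratic_bound[OF i, of y] unfolding synthesis_sum_square Y_def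
    by (simp add: algebra_simps abs_le_iff)
  finally have Y2: "Y\<^sup>2 \<le> (1 + (real d - 1) * \<nu>) * Y * (\<Sum>b<p. (Z b)\<^sup>2)"
    by (simp add: mult_right_mono sum_nonneg)
  have "Y \<le> (1 + (real d - 1) * \<nu>) * (\<Sum>b<p. (Z b)\<^sup>2)"
  proof (cases "Y = 0")
    case False
    then have "Y > 0" using Y0 by simp
    then show ?thesis
      using Y2 by (simp add: power2_eq_square mult_ac)
  qed (use lam in \<open>simp add: sum_nonneg\<close>)
  moreover have "(block_corr L d D w i)\<^sup>2 = Y"
    using Y0 by (simp add: block_corr_def Y_def y_def)
  ultimately show ?thesis by (simp add: Z_def)
qed

lemma borel_measurable_block_corr:
  "(\<lambda>w. block_corr L d D w i) \<in> borel_measurable (gauss_noise L \<sigma>)"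
  unfolding block_corr_def
  by (intro measurable_compose[OF _ borel_measurable_sqrt] borel_measurable_sum borel_measurable_power borel_measurable_gauss_noise_linear)

lemma prob_block_corr_ge:
  assumes i: "i < M" and \<sigma>: "\<sigma> > 0" and t: "t \<ge> 1"
  shows "measure (gauss_noise L \<sigma>)
      {w \<in> space (gauss_noise L \<sigma>). block_corr L d D w i \<ge> \<sigma> * sqrt ((1 + (real d - 1) * \<nu>) * t)}
    < 0.8 * (real d)\<^sup>2 * t powr (d / 2 - 1) * exp (- t / 2)"
    (is "measure ?G ?B < _")
proof -
  interpret prob_space ?G using \<sigma> by (rule prob_space_gauss_noise)
  define lam where "lam = 1 + (real d - 1) * \<nu>"
  have lam: "lam > 0"
    unfolding lam_def using d_pos sub_coherence_bounds(1) by (intro add_pos_nonneg mult_nonneg_nonneg) auto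
  obtain p q c where p: "p \<le> d" and q: "orthonormal L p q"
    and c: "\<And>a l. a < d \<Longrightarrow> l < L \<Longrightarrow> D l (i * d + a) = (\<Sum>b<p. c a b * q b l)"
    using gram_schmidt[of d L "\<lambda>a l. D l (i * d + a)"] by blast
  define Q where "Q = (\<lambda>w. \<Sum>b<p. (\<Sum>l<L. q b l * w l)\<^sup>2)"
  have Qm: "Q \<in> borel_measurable ?G"
    unfolding Q_def
    by (intro borel_measurable_sum borel_measurable_power borel_measurable_gauss_noise_linear)
  have sub: "Q w \<ge> \<sigma>\<^sup>2 * t" if "block_corr L d D w i \<ge> \<sigma> * sqrt (lam * t)" for w
  proof -
    have "(\<sigma> * sqrt (lam * t))\<^sup>2 \<le> (block_corr L d D w i)\<^sup>2"
      using that \<sigma> lam t by (intro power_mono) auto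
    also have "\<dots> \<le> lam * Q w"
      unfolding lam_def Q_def by (rule block_corr_le_orthonormal[OF i q c])
    finally have "lam * (\<sigma>\<^sup>2 * t) \<le> lam * Q w"
      using lam t by (simp add: power_mult_distrib mult_ac)
    then show ?thesis using lam by simp
  qed
  show ?thesis
  proof (cases "p = 0")
    \<comment> \<open>The chi-square bound is stated for \<open>p > 0\<close>; here \<open>Q\<close>
      is constantly 0, so the event is empty.\<close>
    case True
    have "\<sigma>\<^sup>2 * t > 0" using \<sigma> t by simp
    then have "?B = {}"
      using sub True by (force simp: Q_def simp flip: lam_def)
    moreover have "0 < 0.8 * (real d)\<^sup>2 * t powr (d / 2 - 1) * exp (- t / 2)"
      using d_pos t by simp
    ultimately show ?thesis by (simp only: measure_empty)
  next
    case False
    have "measure ?G ?B \<le> measure ?G {w \<in> space ?G. Q w \<ge> \<sigma>\<^sup>2 * t}"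
    proof (rule finite_measure_mono)
      show "?B \<subseteq> {w \<in> space ?G. Q w \<ge> \<sigma>\<^sup>2 * t}"
        using sub by (auto simp flip: lam_def)
      show "{w \<in> space ?G. Q w \<ge> \<sigma>\<^sup>2 * t} \<in> sets ?G"
        using Qm by measurable
    qed
    also have "\<dots> < 0.8 * (real p)\<^sup>2 * t powr (p / 2 - 1) * exp (- t / 2)"
      unfolding Q_def using False by (intro prob_orthonormal_gauss_noise[OF q _ \<sigma> t]) auto
    \<comment> \<open>\<open>t \<ge> 1\<close> makes the bound increase with the number of degrees
      of freedom.\<close>
    also have "\<dots> \<le> 0.8 * (real d)\<^sup>2 * t powr (d / 2 - 1) * exp (- t / 2)"
      using p t by (intro mult_mono power_mono powr_mono) (auto simp: divide_right_mono)
    finally show ?thesis .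
  qed
qed

end

section \<open>Correlations of the dictionary with block-sparse combinations\<close>

lemma sum_blocks: "(\<Sum>j<M * d. f j) = (\<Sum>i<M. \<Sum>a<d. f (i * d + a))" for f :: "nat \<Rightarrow> 'a :: comm_monoid_add"
proof -
  have "sum f {i * d..<i * d + d} = (\<Sum>a<d. f (i * d + a))" for i
    using sum.shift_bounds_nat_ivl[of f 0 "i * d" d] by (simp add: atLeast0LessThan add.commute)
  then show ?thesis
    by (simp flip: sum.nat_group)
qed

context block_dictionary
begin

lemma block_norm_eq_L2_set: "block_norm d v i = L2_set (\<lambda>a. v (i * d + a)) {..<d}"
  by (simp add: block_norm_def L2_set_def)

lemma block_corr_eq_L2_set:
  "block_corr L d D r i = L2_set (\<lambda>a. \<Sum>l<L. D l (i * d + a) * r l) {..<d}"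
  by (simp add: block_corr_def L2_set_def)

lemma sum_square_blocks:
  assumes "supported_in (M * d) d e I" "I \<subseteq> {..<M}"
  shows "(\<Sum>j<M * d. (e j)\<^sup>2) = (\<Sum>i\<in>I. (block_norm d e i)\<^sup>2)"
proof -
  have "(\<Sum>j<M * d. (e j)\<^sup>2) = (\<Sum>i<M. (block_norm d e i)\<^sup>2)"
    by (simp add: sum_blocks block_norm_eq_L2_set L2_set_power2)
  also have "\<dots> = (\<Sum>i\<in>I. (block_norm d e i)\<^sup>2)"
    using assms d_pos by (intro sum.mono_neutral_right)
      (auto simp: block_norm_def supported_in_def index_less)
  finally show ?thesis .
qed

lemma corr_mat_vec:
  assumes "supported_in (M * d) d e I" "I \<subseteq> {..<M}"
  shows "(\<Sum>l<L. D l (i * d + a) * mat_vec L (M * d) D e l)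
    = (\<Sum>j\<in>I. \<Sum>b<d. gram i j a b * e (j * d + b))"
proof -
  have "mat_vec L (M * d) D e l = (\<Sum>j\<in>I. \<Sum>b<d. D l (j * d + b) * e (j * d + b))" for l
  proof -
    have "mat_vec L (M * d) D e l = (\<Sum>j<M. \<Sum>b<d. D l (j * d + b) * e (j * d + b))"
      by (simp add: mat_vec_def sum_blocks)
    also have "\<dots> = (\<Sum>j\<in>I. \<Sum>b<d. D l (j * d + b) * e (j * d + b))"
      using assms d_pos by (intro sum.mono_neutral_right)
        (auto simp: supported_in_def index_less intro!: sum.neutral)
    finally show ?thesis .
  qed
  then have "(\<Sum>l<L. D l (i * d + a) * mat_vec L (M * d) D e l)
    = (\<Sum>l<L. \<Sum>j\<in>I. \<Sum>b<d. D l (i * d + a) * D l (j * d + b) * e (j * d + b))"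
    by (simp add: sum_distrib_left mult.assoc)
  also have "\<dots> = (\<Sum>j\<in>I. \<Sum>l<L. \<Sum>b<d. D l (i * d + a) * D l (j * d + b) * e (j * d + b))"
    by (rule sum.swap)
  also have "\<dots> = (\<Sum>j\<in>I. \<Sum>b<d. \<Sum>l<L. D l (i * d + a) * D l (j * d + b) * e (j * d + b))"
    by (intro sum.cong refl sum.swap)
  finally show ?thesis
    by (simp add: block_gram_def sum_distrib_right)
qed

text \<open>Triangle inequality over the blocks, each cross Gram matrix having spectral norm at most
  \<open>d * \<mu>\<close>.\<close>

lemma off_diagonal_blocks_le:
  assumes "i < M" "J \<subseteq> {..<M}" "i \<notin> J"
  shows "L2_set (\<lambda>a. \<Sum>j\<in>J. \<Sum>b<d. gram i j a b * e (j * d + b)) {..<d}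
    \<le> d * \<mu> * (\<Sum>j\<in>J. block_norm d e j)"
proof -
  have "L2_set (\<lambda>a. \<Sum>b<d. gram i j a b * e (j * d + b)) {..<d} \<le> d * \<mu> * block_norm d e j" if "j \<in> J" for j
  proof -
    have "L2_set (\<lambda>a. \<Sum>b<d. gram i j a b * e (j * d + b)) {..<d} \<le> spec_norm d d (gram i j) * block_norm d e j"
      unfolding block_norm_eq_L2_set by (rule L2_set_mat_le_spec_norm)
    also have "\<dots> \<le> d * \<mu> * block_norm d e j"
      using assms that by (intro mult_right_mono block_coherence_bounds) (auto simp: block_norm_eq_L2_set)
    finally show ?thesis .
  qed
  then show ?thesis
    unfolding sum_distrib_left by (rule order_trans[OF L2_set_sum_le sum_mono])
qed

lemma block_corr_mat_vec_le:
  assumes "supported_in (M * d) d e I" "I \<subseteq> {..<M}" "i < M" "i \<notin> I"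
  shows "block_corr L d D (mat_vec L (M * d) D e) i \<le> d * \<mu> * (\<Sum>j\<in>I. block_norm d e j)"
  unfolding block_corr_eq_L2_set corr_mat_vec[OF assms(1,2)]
  by (rule off_diagonal_blocks_le) (use assms in auto)

text \<open>The diagonal part \<open>g\<close> is paired with the block of \<open>e\<close>: the
  quadratic form is at least \<open>(1 - (d - 1) * \<nu>) * E\<^sup>2\<close> and at most
  \<open>E * L2_set g {..<d}\<close>, so one factor \<open>E\<close> cancels. The other blocks enter
  as the perturbation \<open>h\<close>.\<close>

lemma block_corr_mat_vec_ge:
  assumes e: "supported_in (M * d) d e I" and I: "I \<subseteq> {..<M}" and i: "i \<in> I"
  shows "(1 - (real d - 1) * \<nu>) * block_norm d e i - d * \<mu> * (\<Sum>j\<in>I - {i}. block_norm d e j)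
    \<le> block_corr L d D (mat_vec L (M * d) D e) i"
proof -
  define E where "E = block_norm d e i"
  define g where "g = (\<lambda>a. \<Sum>b<d. gram i i a b * e (i * d + b))"
  define h where "h = (\<lambda>a. \<Sum>j\<in>I - {i}. \<Sum>b<d. gram i j a b * e (j * d + b))"
  have finI: "finite I" using I finite_subset by blast
  have iM: "i < M" using i I by auto
  have E2: "E\<^sup>2 = (\<Sum>a<d. (e (i * d + a))\<^sup>2)"
    by (simp add: E_def block_norm_eq_L2_set L2_set_power2)
  have E0: "E \<ge> 0" by (simp add: E_def block_norm_eq_L2_set)
  have "(1 - (real d - 1) * \<nu>) * E\<^sup>2 \<le> (\<Sum>a<d. \<Sum>b<d. e (i * d + a) * e (i * d + b) * gram i i a b)"
    using gram_quadratic_bound[OF iM, of "\<lambda>a. e (i * d + a)"] unfolding E2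
    by (simp add: algebra_simps abs_le_iff)
  also have "\<dots> = (\<Sum>a<d. e (i * d + a) * g a)"
    by (simp add: g_def sum_distrib_left mult_ac)
  also have "\<dots> \<le> E * L2_set g {..<d}"
    unfolding E_def block_norm_eq_L2_set by (rule sum_mult_le_L2_set)
  finally have "(1 - (real d - 1) * \<nu>) * E\<^sup>2 \<le> E * L2_set g {..<d}" .
  then have g: "(1 - (real d - 1) * \<nu>) * E \<le> L2_set g {..<d}"
    using E0 by (cases "E = 0") (auto simp: power2_eq_square mult_ac less_le)
  have h: "L2_set h {..<d} \<le> d * \<mu> * (\<Sum>j\<in>I - {i}. block_norm d e j)"
    unfolding h_def by (rule off_diagonal_blocks_le) (use iM I in auto)
  have "(\<lambda>a. \<Sum>l<L. D l (i * d + a) * mat_vec L (M * d) D e l) = (\<lambda>a. g a + h a)"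
    unfolding corr_mat_vec[OF e I] g_def h_def using finI i by (simp add: sum.remove)
  then show ?thesis
    using g h L2_set_diff_ge[of g "{..<d}" h] unfolding block_corr_eq_L2_set E_def by simp
qed

subsection \<open>Least squares and greedy selection\<close>

text \<open>Perturbing one coefficient of a least-squares minimiser by the correlation \<open>C\<close> of its column
  with the residual would lower the squared residual by \<open>C\<^sup>2\<close>.\<close>

lemma normal_equations:
  assumes supp: "supported_in (M * d) d v I"
    and min: "\<And>z. supported_in (M * d) d z I \<Longrightarrow>
      sqnorm L (\<lambda>r. y r - mat_vec L (M * d) D v r) \<le> sqnorm L (\<lambda>r. y r - mat_vec L (M * d) D z r)"
    and i: "i \<in> I" "i < M" and a: "a < d"
  shows "(\<Sum>l<L. D l (i * d + a) * (y l - mat_vec L (M * d) D v l)) = 0"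
proof -
  define j where "j = i * d + a"
  define r where "r = (\<lambda>l. y l - mat_vec L (M * d) D v l)"
  define C where "C = (\<Sum>l<L. D l j * r l)"
  define z where "z = v(j := v j + C)"
  have jN: "j < M * d" unfolding j_def using i a by (intro index_less)
  have jd: "j div d = i" using a by (simp add: j_def)
  have "supported_in (M * d) d z I"
    using supp i jd by (auto simp: supported_in_def z_def)
  then have "sqnorm L r \<le> sqnorm L (\<lambda>l. y l - mat_vec L (M * d) D z l)"
    unfolding r_def by (rule min)
  also have "mat_vec L (M * d) D z l = mat_vec L (M * d) D v l + C * D l j" for l
  proof -
    have "mat_vec L (M * d) D z l = (\<Sum>m<M * d. D l m * v m + (if m = j then C * D l j else 0))"
      unfolding mat_vec_def z_def by (intro sum.cong) (auto simp: algebra_simps)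
    then show ?thesis using jN by (simp add: sum.distrib mat_vec_def)
  qed
  then have "sqnorm L (\<lambda>l. y l - mat_vec L (M * d) D z l) = (\<Sum>l<L. (r l - C * D l j)\<^sup>2)"
    by (simp add: sqnorm_def r_def algebra_simps)
  also have "\<dots> = (\<Sum>l<L. (r l)\<^sup>2 - 2 * C * (D l j * r l) + C\<^sup>2 * (D l j)\<^sup>2)"
    by (intro sum.cong refl) (simp add: power2_eq_square algebra_simps)
  also have "\<dots> = sqnorm L r - 2 * C * C + C\<^sup>2 * (\<Sum>l<L. (D l j)\<^sup>2)"
    by (simp add: sum.distrib sum_subtractf sqnorm_def C_def flip: sum_distrib_left)
  also have "\<dots> = sqnorm L r - C\<^sup>2"
    using unit_cols[OF jN] by (simp add: power2_eq_square)
  finally have "C = 0" by simp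
  then show ?thesis by (simp add: C_def j_def r_def)
qed

lemma block_corr_eq_0_of_minimizer:
  assumes "supported_in (M * d) d v I"
    and "\<And>z. supported_in (M * d) d z I \<Longrightarrow>
      sqnorm L (\<lambda>r. y r - mat_vec L (M * d) D v r) \<le> sqnorm L (\<lambda>r. y r - mat_vec L (M * d) D z r)"
    and "i \<in> I" "i < M"
  shows "block_corr L d D (\<lambda>r. y r - mat_vec L (M * d) D v r) i = 0"
  using normal_equations[OF assms] by (simp add: block_corr_def)

lemma mat_vec_diff: "mat_vec L N D (\<lambda>j. u j - v j) l = mat_vec L N D u l - mat_vec L N D v l"
  by (simp add: mat_vec_def right_diff_distrib sum_subtractf)

lemma block_corr_add_le: "block_corr L d D (\<lambda>l. u l + v l) i \<le> block_corr L d D u i + block_corr L d D v i"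
  unfolding block_corr_eq_L2_set by (simp add: distrib_left sum.distrib L2_set_triangle_ineq)

lemma block_corr_add_ge: "block_corr L d D u i - block_corr L d D v i \<le> block_corr L d D (\<lambda>l. u l + v l) i"
  unfolding block_corr_eq_L2_set by (simp add: distrib_left sum.distrib L2_set_diff_ge)

lemma supported_in_block_supp: "supported_in (M * d) d x (block_supp M d x)"
  unfolding supported_in_def block_supp_def
proof (intro allI impI)
  fix j assume j: "j < M * d" "j div d \<notin> {i. i < M \<and> (\<exists>a<d. x (i * d + a) \<noteq> 0)}"
  then have "j div d < M" "j mod d < d"
    using d_pos by (auto simp: less_mult_imp_div_less)
  with j(2) have "x (j div d * d + j mod d) = 0" by blast
  then show "x j = 0" by simp
qed

text \<open>With \<open>E\<close> the largest block norm of the error, attained at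
  \<open>i1\<close>, the correlation at \<open>i1\<close> exceeds
  \<open>(\<beta> - (s - 1) * \<delta>) * E - \<tau>\<close>, while outside \<open>S\<close> it
  stays below \<open>\<delta> * s * E + \<tau>\<close>. The inequality \<open>gap\<close> separates
  the two.\<close>

lemma greedy_step:
  assumes S: "S = block_supp M d x" and Sk: "card S \<le> k"
    and w: "\<And>i. i < M \<Longrightarrow> block_corr L d D w i < \<tau>"
    and m_pos: "m > 0" and m: "\<And>i. i \<in> S \<Longrightarrow> m \<le> block_norm d x i"
    and cond: "(1 - (real d - 1) * \<nu>) * m - (2 * real k - 1) * real d * \<mu> * m \<ge> 2 * \<tau>"
    and IS: "I \<subset> S" and v: "supported_in (M * d) d v I"
    and orth: "\<And>i. i \<in> I \<Longrightarrow> block_corr L d D r i = 0"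
    and r: "r = (\<lambda>l. mat_vec L (M * d) D x l + w l - mat_vec L (M * d) D v l)"
    and i0: "i0 < M" and best: "\<And>i. i < M \<Longrightarrow> block_corr L d D r i \<le> block_corr L d D r i0"
  shows "i0 \<in> S - I"
proof -
  define e where "e = (\<lambda>j. x j - v j)"
  define s where "s = card S"
  define \<beta> where "\<beta> = 1 - (real d - 1) * \<nu>"
  have SM: "S \<subseteq> {..<M}" by (auto simp: S block_supp_def)
  then have finS: "finite S" using finite_subset by blast
  have e: "supported_in (M * d) d e S"
    using supported_in_block_supp[of x] v IS unfolding supported_in_def e_def S by auto
  have re: "r = (\<lambda>l. mat_vec L (M * d) D e l + w l)"
    unfolding r e_def by (simp add: mat_vec_diff algebra_simps)
  obtain j where j: "j \<in> S" "j \<notin> I" using IS by auto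
  define n where "n = block_norm d e"
  have n0: "n i \<ge> 0" for i by (simp add: n_def block_norm_eq_L2_set)
  obtain i1 where i1: "i1 \<in> S" "\<And>i. i \<in> S \<Longrightarrow> n i \<le> n i1"
  proof -
    have "Max (n ` S) \<in> n ` S" using finS j by (intro Max_in) auto
    then obtain i1 where "i1 \<in> S" "n i1 = Max (n ` S)" by auto
    then show ?thesis using finS that[of i1] by simp
  qed
  define E where "E = n i1"
  \<comment> \<open>Block \<open>j\<close> of \<open>S\<close> has not been chosen, so
    \<open>v\<close> vanishes there and the error agrees with \<open>x\<close>.\<close>
  have "m \<le> E"
  proof -
    have "e (j * d + a) = x (j * d + a)" if "a < d" for a
      using v j SM that index_less[of j a] by (auto simp: e_def supported_in_def)
    then have "n j = block_norm d x j"
      by (simp add: n_def block_norm_def)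
    then show ?thesis using m[OF j(1)] i1(2)[OF j(1)] by (simp add: E_def)
  qed
  then have E: "E > 0" using m_pos by simp
  have s: "1 \<le> s" "s \<le> k" using j finS Sk by (auto simp: s_def Suc_le_eq card_gt_0_iff)
  define \<delta> where "\<delta> = real d * \<mu>"
  have \<delta>: "\<delta> \<ge> 0" by (simp add: \<delta>_def block_coherence_bounds)
  have \<tau>: "\<tau> > 0"
    using w[OF i0] by (rule le_less_trans[rotated]) (simp add: block_corr_eq_L2_set)
  \<comment> \<open>Lowering \<open>k\<close> to \<open>s\<close> only enlarges the bracket; the
    bracket is positive because \<open>\<tau> > 0\<close>, which permits replacing \<open>m\<close>
    by \<open>E\<close>.\<close>
  have gap: "2 * \<tau> \<le> (\<beta> - (2 * real s - 1) * \<delta>) * E"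
  proof -
    have "2 * \<tau> \<le> (\<beta> - (2 * real k - 1) * \<delta>) * m"
      using cond by (simp add: \<beta>_def \<delta>_def algebra_simps)
    also have "\<dots> \<le> (\<beta> - (2 * real s - 1) * \<delta>) * m"
      using s \<delta> m_pos by (intro mult_right_mono diff_left_mono) auto
    finally have 1: "2 * \<tau> \<le> (\<beta> - (2 * real s - 1) * \<delta>) * m" .
    with \<tau> have "0 < (\<beta> - (2 * real s - 1) * \<delta>) * m" by linarith
    then have "0 < \<beta> - (2 * real s - 1) * \<delta>" using m_pos by (simp add: zero_less_mult_iff)
    then have "(\<beta> - (2 * real s - 1) * \<delta>) * m \<le> (\<beta> - (2 * real s - 1) * \<delta>) * E"
      using \<open>m \<le> E\<close> by (intro mult_left_mono) auto
    with 1 show ?thesis by linarith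
  qed
  have i1M: "i1 < M" using i1 SM by auto
  have lower: "\<delta> * s * E + \<tau> < block_corr L d D r i1"
  proof -
    have "(\<Sum>j\<in>S - {i1}. n j) \<le> real (card (S - {i1})) * E"
      using i1 by (intro sum_bounded_above) (auto simp: E_def)
    also have "card (S - {i1}) = s - 1" using i1 finS by (simp add: s_def)
    finally have "(\<Sum>j\<in>S - {i1}. n j) \<le> (real s - 1) * E" using s by (simp add: of_nat_diff)
    then have "\<delta> * (\<Sum>j\<in>S - {i1}. n j) \<le> \<delta> * ((real s - 1) * E)"
      using \<delta> by (rule mult_left_mono)
    moreover have "\<beta> * E - \<delta> * (\<Sum>j\<in>S - {i1}. n j) \<le> block_corr L d D (mat_vec L (M * d) D e) i1"
      using block_corr_mat_vec_ge[OF e SM i1(1)] by (simp add: \<beta>_def \<delta>_def n_def E_def)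
    moreover have "block_corr L d D (mat_vec L (M * d) D e) i1 - block_corr L d D w i1 \<le> block_corr L d D r i1"
      unfolding re by (rule block_corr_add_ge)
    moreover have "block_corr L d D w i1 < \<tau>" by (rule w[OF i1M])
    ultimately show ?thesis using gap by (simp add: algebra_simps)
  qed
  have "block_corr L d D r i1 \<le> block_corr L d D r i0" by (rule best[OF i1M])
  note lower = less_le_trans[OF lower this]
  have "i0 \<in> S"
  proof (rule ccontr)
    assume i0S: "i0 \<notin> S"
    have "(\<Sum>j\<in>S. n j) \<le> real s * E"
      unfolding s_def using i1 by (intro sum_bounded_above) (auto simp: E_def)
    then have "\<delta> * (\<Sum>j\<in>S. n j) \<le> \<delta> * (real s * E)"
      using \<delta> by (rule mult_left_mono)
    moreover have "block_corr L d D (mat_vec L (M * d) D e) i0 \<le> \<delta> * (\<Sum>j\<in>S. n j)"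
      using block_corr_mat_vec_le[OF e SM i0 i0S] by (simp add: \<delta>_def n_def)
    moreover have "block_corr L d D r i0 \<le> block_corr L d D (mat_vec L (M * d) D e) i0 + block_corr L d D w i0"
      unfolding re by (rule block_corr_add_le)
    moreover have "block_corr L d D w i0 < \<tau>" by (rule w[OF i0])
    ultimately show False using lower by (simp add: mult.assoc)
  qed
  moreover have "i0 \<notin> I"
  proof
    assume "i0 \<in> I"
    then have "\<delta> * s * E + \<tau> < 0" using lower orth by simp
    moreover have "0 \<le> \<delta> * s * E" using \<delta> E by simp
    ultimately show False using \<tau> by linarith
  qed
  ultimately show ?thesis by simp
qed

text \<open>Multiplying the lower bound for block \<open>i\<close> by \<open>n i\<close> and summing
  gives \<open>\<gamma> * A \<le> \<tau> * (\<Sum>i\<in>I. n i)\<close>, the off-diagonal terms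
  being absorbed into \<open>\<gamma>\<close>. After squaring, Cauchy-Schwarz bounds the sum by
  \<open>A * card I\<close>, and one factor \<open>A\<close> cancels.\<close>

lemma least_squares_error:
  assumes e: "supported_in (M * d) d e I" and I: "I \<subseteq> {..<M}" and Ik: "card I \<le> k"
    and corr: "\<And>i. i \<in> I \<Longrightarrow> block_corr L d D (mat_vec L (M * d) D e) i \<le> \<tau>"
    and \<tau>: "\<tau> \<ge> 0"
    and pos: "1 - (real d - 1) * \<nu> - (real k - 1) * real d * \<mu> > 0"
  shows "(\<Sum>j<M * d. (e j)\<^sup>2) \<le> real k * \<tau>\<^sup>2 / (1 - (real d - 1) * \<nu> - (real k - 1) * real d * \<mu>)\<^sup>2"
proof -
  define n where "n = block_norm d e"
  define \<beta> where "\<beta> = 1 - (real d - 1) * \<nu>"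
  define \<delta> where "\<delta> = real d * \<mu>"
  define \<gamma> where "\<gamma> = \<beta> - (real k - 1) * \<delta>"
  define A where "A = (\<Sum>i\<in>I. (n i)\<^sup>2)"
  have \<delta>: "\<delta> \<ge> 0" by (simp add: \<delta>_def block_coherence_bounds)
  have finI: "finite I" using I finite_subset by blast
  have n0: "n i \<ge> 0" for i by (simp add: n_def block_norm_eq_L2_set)
  have \<gamma>: "\<gamma> > 0" using pos by (simp add: \<gamma>_def \<beta>_def \<delta>_def algebra_simps)
  have A0: "A \<ge> 0" by (simp add: A_def sum_nonneg)
  have "\<beta> * (n i)\<^sup>2 \<le> \<tau> * n i + \<delta> * (\<Sum>j\<in>I - {i}. \<bar>n i\<bar> * \<bar>n j\<bar>)" if i: "i \<in> I" for i
  proof -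
    have "\<beta> * n i - \<delta> * (\<Sum>j\<in>I - {i}. n j) \<le> \<tau>"
      using block_corr_mat_vec_ge[OF e I i] corr[OF i] by (simp add: \<beta>_def \<delta>_def n_def)
    from mult_right_mono[OF this n0[of i]] show ?thesis
      using n0 by (simp add: algebra_simps power2_eq_square sum_distrib_left)
  qed
  then have "(\<Sum>i\<in>I. \<beta> * (n i)\<^sup>2) \<le> (\<Sum>i\<in>I. \<tau> * n i + \<delta> * (\<Sum>j\<in>I - {i}. \<bar>n i\<bar> * \<bar>n j\<bar>))"
    by (rule sum_mono)
  then have "\<beta> * A \<le> \<tau> * (\<Sum>i\<in>I. n i) + \<delta> * (\<Sum>i\<in>I. \<Sum>j\<in>I - {i}. \<bar>n i\<bar> * \<bar>n j\<bar>)"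
    by (simp add: A_def sum.distrib sum_distrib_left)
  also have "\<dots> \<le> \<tau> * (\<Sum>i\<in>I. n i) + \<delta> * ((real (card I) - 1) * A)"
    unfolding A_def by (intro add_left_mono mult_left_mono sum_off_diagonal_le finI \<delta>)
  also have "\<dots> \<le> \<tau> * (\<Sum>i\<in>I. n i) + \<delta> * ((real k - 1) * A)"
    using Ik A0 \<delta> by (intro add_left_mono mult_left_mono mult_right_mono) auto
  finally have 1: "\<gamma> * A \<le> \<tau> * (\<Sum>i\<in>I. n i)"
    by (simp add: \<gamma>_def algebra_simps)
  have "(\<gamma> * A)\<^sup>2 \<le> \<tau>\<^sup>2 * (\<Sum>i\<in>I. n i)\<^sup>2"
    unfolding power_mult_distrib[symmetric] using 1 \<gamma> A0 by (intro power_mono) auto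
  also have "\<dots> \<le> \<tau>\<^sup>2 * (A * real (card I))"
    unfolding A_def by (intro mult_left_mono sum_squared_le_sum_of_squares) auto
  also have "\<dots> \<le> \<tau>\<^sup>2 * (A * real k)"
    using Ik A0 by (intro mult_left_mono) auto
  finally have "(\<gamma>\<^sup>2 * A) * A \<le> (\<tau>\<^sup>2 * real k) * A"
    by (simp add: power_mult_distrib power2_eq_square mult_ac)
  then have "\<gamma>\<^sup>2 * A \<le> \<tau>\<^sup>2 * real k"
    using A0 by (cases "A = 0") (auto simp: less_le)
  then have "A \<le> real k * \<tau>\<^sup>2 / \<gamma>\<^sup>2"
    using \<gamma> by (simp add: pos_le_divide_eq mult.commute)
  moreover have "(\<Sum>j<M * d. (e j)\<^sup>2) = A"
    unfolding A_def n_def by (rule sum_square_blocks[OF e I])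
  ultimately show ?thesis
    by (simp add: \<gamma>_def \<beta>_def \<delta>_def mult.assoc)
qed

text \<open>The deterministic part: noise enters only through \<open>\<tau>\<close>. The first
  \<open>card S\<close> choices exhaust \<open>S\<close>, and the least-squares bound is applied to
  the set of all \<open>k\<close> choices.\<close>

lemma bomp_recovery:
  assumes S: "S = block_supp M d x" and Sk: "card S \<le> k" and S_ne: "S \<noteq> {}"
    and w: "\<And>i. i < M \<Longrightarrow> block_corr L d D w i < \<tau>"
    and m_pos: "m > 0" and m: "\<And>i. i \<in> S \<Longrightarrow> m \<le> block_norm d x i"
    and cond: "(1 - (real d - 1) * \<nu>) * m - (2 * real k - 1) * real d * \<mu> * m \<ge> 2 * \<tau>"
    and run: "bomp_run L M d D k (\<lambda>l. mat_vec L (M * d) D x l + w l) idx xs"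
  shows "S \<subseteq> idx ` {..<k}"
    and "(\<Sum>j<M * d. (xs (k - 1) j - x j)\<^sup>2)
      \<le> real k * \<tau>\<^sup>2 / (1 - (real d - 1) * \<nu> - (real k - 1) * real d * \<mu>)\<^sup>2"
proof -
  define y where "y = (\<lambda>l. mat_vec L (M * d) D x l + w l)"
  have SM: "S \<subseteq> {..<M}" by (auto simp: S block_supp_def)
  then have finS: "finite S" using finite_subset by blast
  have k: "k \<ge> 1" using S_ne finS Sk by (metis One_nat_def Suc_leI card_gt_0_iff le_trans)
  have idxM: "idx l < M" if "l < k" for l
    using run that by (simp add: bomp_run_def)
  have supp: "supported_in (M * d) d (xs l) (idx ` {..<Suc l})" if "l < k" for l
    using run that by (simp add: bomp_run_def lessThan_Suc_atMost)
  have corr0: "block_corr L d D (\<lambda>l. y l - mat_vec L (M * d) D (xs l') l) i = 0"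
    if "l' < k" "i \<in> idx ` {..<Suc l'}" for l' i
  proof (rule block_corr_eq_0_of_minimizer[OF supp])
    show "sqnorm L (\<lambda>r. y r - mat_vec L (M * d) D (xs l') r) \<le> sqnorm L (\<lambda>r. y r - mat_vec L (M * d) D z r)"
      if "supported_in (M * d) d z (idx ` {..<Suc l'})" for z
      using run that \<open>l' < k\<close> by (simp add: bomp_run_def lessThan_Suc_atMost y_def)
  qed (use that idxM in auto)
  \<comment> \<open>The cardinality records distinctness, so after \<open>card S\<close> steps the
    chosen set must be all of \<open>S\<close>.\<close>
  have greedy: "idx ` {..<l} \<subseteq> S \<and> card (idx ` {..<l}) = l" if "l \<le> card S" for l
    using that
  proof (induction l)
    case (Suc l)
    then have IH: "idx ` {..<l} \<subseteq> S" "card (idx ` {..<l}) = l" by auto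
    have lk: "l < k" using Suc.prems Sk by simp
    \<comment> \<open>The iterate before step \<open>l\<close> is \<open>xs (l - 1)\<close>; at
      \<open>l = 0\<close> the zero vector stands in for it, since the residual is then
      \<open>y\<close> itself.\<close>
    define v where "v = (if l = 0 then (\<lambda>_. 0) else xs (l - 1))"
    define r where "r = (\<lambda>r. y r - mat_vec L (M * d) D v r)"
    have r: "bomp_residual L (M * d) D y xs l = r"
      by (auto simp: bomp_residual_def r_def v_def mat_vec_def)
    have "idx l \<in> S - idx ` {..<l}"
    proof (rule greedy_step[OF S Sk w m_pos m cond, where v = v and r = r])
      show "idx ` {..<l} \<subset> S" using IH Suc.prems by auto
      show "supported_in (M * d) d v (idx ` {..<l})"
        using supp[of "l - 1"] lk by (cases l) (auto simp: v_def supported_in_def)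
      show "block_corr L d D r i = 0" if "i \<in> idx ` {..<l}" for i
        using corr0[of "l - 1" i] lk that by (cases l) (auto simp: v_def r_def)
      show "r = (\<lambda>l. mat_vec L (M * d) D x l + w l - mat_vec L (M * d) D v l)"
        by (simp add: r_def y_def)
      show "idx l < M" using idxM lk by simp
      show "block_corr L d D r i \<le> block_corr L d D r (idx l)" if "i < M" for i
        using run lk that unfolding bomp_run_def y_def[symmetric] r[symmetric] by blast
    qed
    then show ?case
      using IH by (simp add: lessThan_Suc)
  qed simp
  have "idx ` {..<card S} = S"
    using greedy[of "card S"] finS by (intro card_subset_eq) auto
  then show sub: "S \<subseteq> idx ` {..<k}"
    using Sk by (metis image_mono lessThan_subset_iff)
  define I where "I = idx ` {..<k}"
  define e where "e = (\<lambda>j. x j - xs (k - 1) j)"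
  define \<delta> where "\<delta> = real d * \<mu>"
  have \<tau>: "\<tau> > 0"
  proof -
    obtain i where "i < M" using S_ne SM by auto
    from w[OF this] show ?thesis
      by (rule le_less_trans[rotated]) (simp add: block_corr_eq_L2_set)
  qed
  have "(\<Sum>j<M * d. (e j)\<^sup>2) \<le> real k * \<tau>\<^sup>2 / (1 - (real d - 1) * \<nu> - (real k - 1) * real d * \<mu>)\<^sup>2"
  proof (rule least_squares_error)
    show "supported_in (M * d) d e I"
      using supported_in_block_supp[of x] supp[of "k - 1"] sub k
      unfolding supported_in_def e_def I_def S by auto
    show "I \<subseteq> {..<M}" using idxM by (auto simp: I_def)
    \<comment> \<open>Distinctness is established only for the first \<open>card S\<close> choices,
      hence an inequality.\<close>
    show "card I \<le> k" unfolding I_def by (metis card_image_le card_lessThan finite_lessThan)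
    show "\<tau> \<ge> 0" using \<tau> by simp
    show "block_corr L d D (mat_vec L (M * d) D e) i \<le> \<tau>" if "i \<in> I" for i
    proof -
      have iM: "i < M" using that idxM by (auto simp: I_def)
      \<comment> \<open>The final residual is \<open>D e + w\<close> and has correlation 0 with the
        chosen blocks, so the correlation of \<open>D e\<close> is at most that of
        \<open>w\<close>.\<close>
      have "block_corr L d D (mat_vec L (M * d) D e) i - block_corr L d D w i
         \<le> block_corr L d D (\<lambda>l. mat_vec L (M * d) D e l + w l) i"
        by (rule block_corr_add_ge)
      also have "(\<lambda>l. mat_vec L (M * d) D e l + w l) = (\<lambda>l. y l - mat_vec L (M * d) D (xs (k - 1)) l)"
        by (simp add: e_def y_def mat_vec_diff algebra_simps)
      also have "block_corr L d D \<dots> i = 0"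
        using corr0[of "k - 1" i] k that by (simp add: I_def)
      finally show ?thesis using w[OF iM] by linarith
    qed
    have \<delta>: "\<delta> \<ge> 0" by (simp add: \<delta>_def block_coherence_bounds)
    \<comment> \<open>The recovery condition with \<open>\<tau> > 0\<close> makes the bracket with
      \<open>2 * k - 1\<close> positive, and the denominator subtracts no more than it.\<close>
    have "0 < (1 - (real d - 1) * \<nu> - (2 * real k - 1) * \<delta>) * m"
      using cond \<tau> by (simp add: \<delta>_def algebra_simps)
    then have "0 < 1 - (real d - 1) * \<nu> - (2 * real k - 1) * \<delta>"
      using m_pos by (simp add: zero_less_mult_iff)
    moreover have "(real k - 1) * \<delta> \<le> (2 * real k - 1) * \<delta>"
      using \<delta> by (intro mult_right_mono) auto
    ultimately show "1 - (real d - 1) * \<nu> - (real k - 1) * real d * \<mu> > 0"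
      by (simp add: \<delta>_def mult.assoc)
  qed
  then show "(\<Sum>j<M * d. (xs (k - 1) j - x j)\<^sup>2)
      \<le> real k * \<tau>\<^sup>2 / (1 - (real d - 1) * \<nu> - (real k - 1) * real d * \<mu>)\<^sup>2"
    by (simp add: e_def power2_commute)
qed

end

section \<open>The union bound over blocks and the conclusion\<close>

theorem theorem5:
  fixes L M d k :: nat and D :: "nat \<Rightarrow> nat \<Rightarrow> real" and x :: "nat \<Rightarrow> real"
    and \<sigma> \<alpha> :: real
  defines "N \<equiv> M * d"
  defines "\<mu>B \<equiv> block_coherence L M d D"
  defines "\<nu> \<equiv> sub_coherence L M d D"
  defines "S \<equiv> block_supp M d x"
  defines "xmin \<equiv> Min (block_norm d x ` S)"
  assumes unit_cols: "\<forall>j<N. (\<Sum>l<L. (D l j)\<^sup>2) = 1"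
    and LN: "L < N"
    and full_rank: "\<forall>I. I \<subseteq> {..<M} \<and> card I \<le> k \<longrightarrow>
             (\<forall>v. supported_in N d v I \<and> (\<forall>l<L. mat_vec L N D v l = 0) \<longrightarrow> (\<forall>j<N. v j = 0))"
    and sparse: "card S \<le> k"
    and x_nz: "\<exists>j<N. x j \<noteq> 0"
    and sigma_pos: "\<sigma> > 0"
    and alpha: "\<alpha> \<ge> 1 / (2 * real d * ln (real N))"
    and cond: "(1 - (real d - 1) * \<nu>) * xmin - (2 * real k - 1) * real d * \<mu>B * xmin
               \<ge> 2 * \<sigma> * sqrt (2 * \<alpha> * real d * (1 + (real d - 1) * \<nu>) * ln (real N))"
  shows "\<exists>A \<in> sets (gauss_noise L \<sigma>).
           measure (gauss_noise L \<sigma>) A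
             > 1 - 0.8 * real d * (2 * \<alpha> * real d * ln (real N)) powr (real d / 2 - 1)
                   / (real N) powr (\<alpha> * real d - 1)
         \<and> (\<forall>w\<in>A. \<forall>idx xs.
              bomp_run L M d D k (\<lambda>l. mat_vec L N D x l + w l) idx xs \<longrightarrow>
                S \<subseteq> idx ` {..<k}
              \<and> (\<Sum>j<N. (xs (k - 1) j - x j)\<^sup>2)
                  \<le> 2 * \<alpha> * (1 + (real d - 1) * \<nu>)
                     / (1 - (real d - 1) * \<nu> - (real k - 1) * real d * \<mu>B)\<^sup>2
                     * real d * real k * \<sigma>\<^sup>2 * ln (real N))"
proof -
  have N0: "N > 0" using LN by simp
  then have d: "d > 0" and M: "M > 0" by (auto simp: N_def)
  interpret block_dictionary L M d D
  proof
    show "(\<Sum>l<L. (D l j)\<^sup>2) = 1" if "j < M * d" for j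
      using unit_cols that by (simp add: N_def)
  qed (rule d)
  \<comment> \<open>A unit column forces \<open>L > 0\<close>; with \<open>L < N\<close> this gives
    \<open>N \<ge> 2\<close> and a positive logarithm.\<close>
  have "(\<Sum>l<L. (D l 0)\<^sup>2) = 1"
    using unit_cols[of 0] N0 by (simp add: N_def)
  then have "L > 0"
    by (cases "L = 0") auto
  then have lnN: "ln (real N) > 0" using LN by simp
  define t where "t = 2 * \<alpha> * real d * ln (real N)"
  define lam where "lam = 1 + (real d - 1) * \<nu>"
  define \<tau> where "\<tau> = \<sigma> * sqrt (lam * t)"
  \<comment> \<open>The lower bound on \<open>\<alpha>\<close> is this inequality, which the tail
    bound requires.\<close>
  have t: "t \<ge> 1"
    using alpha lnN d by (simp add: t_def divide_le_eq mult_ac)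
  have lam: "lam > 0"
    unfolding lam_def \<nu>_def using d sub_coherence_bounds(1) by (intro add_pos_nonneg mult_nonneg_nonneg) auto
  have finS: "finite S" by (simp add: S_def block_supp_def)
  have S_ne: "S \<noteq> {}"
  proof
    assume "S = {}"
    then show False
      using x_nz supported_in_block_supp[of x] by (auto simp: supported_in_def S_def N_def)
  qed
  have xmin: "xmin \<le> block_norm d x i" if "i \<in> S" for i
    unfolding xmin_def using finS that by (intro Min_le) auto
  have xmin_pos: "xmin > 0"
  proof -
    have "block_norm d x i > 0" if "i \<in> S" for i
    proof -
      obtain a where "a < d" "x (i * d + a) \<noteq> 0" using \<open>i \<in> S\<close> by (auto simp: S_def block_supp_def)
      then have "(\<Sum>a<d. (x (i * d + a))\<^sup>2) > 0" by (intro sum_pos2[where i = a]) auto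
      then show ?thesis by (simp add: block_norm_def)
    qed
    then show ?thesis unfolding xmin_def using finS S_ne by (subst Min_gr_iff) auto
  qed
  have cond': "(1 - (real d - 1) * \<nu>) * xmin - (2 * real k - 1) * real d * \<mu>B * xmin \<ge> 2 * \<tau>"
  proof -
    have "2 * \<alpha> * real d * (1 + (real d - 1) * \<nu>) * ln (real N) = lam * t"
      by (simp only: t_def lam_def mult_ac)
    with cond show ?thesis
      by (simp only: \<tau>_def mult.assoc)
  qed
  let ?G = "gauss_noise L \<sigma>"
  interpret G: prob_space ?G using sigma_pos by (rule prob_space_gauss_noise)
  define B where "B = (\<lambda>i. {w \<in> space ?G. block_corr L d D w i \<ge> \<tau>})"
  have B: "B i \<in> sets ?G" for i
    unfolding B_def using borel_measurable_block_corr[of i \<sigma>] by measurable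
  define A where "A = space ?G - (\<Union>i<M. B i)"
  show ?thesis
  proof (intro bexI[of _ A] conjI ballI allI impI)
    show "A \<in> sets ?G" unfolding A_def using B by auto
    define b where "b = 0.8 * (real d)\<^sup>2 * t powr (d / 2 - 1) * exp (- t / 2)"
    have "measure ?G (\<Union>i<M. B i) \<le> (\<Sum>i<M. measure ?G (B i))"
      using B by (intro G.finite_measure_subadditive_finite) auto
    \<comment> \<open>\<open>M > 0\<close> keeps the strict tail bounds strict after
      summation.\<close>
    also have "\<dots> < (\<Sum>i<M. b)"
      using M prob_block_corr_ge[OF _ sigma_pos t]
      by (intro sum_strict_mono) (auto simp: B_def b_def \<tau>_def lam_def \<nu>_def)
    \<comment> \<open>\<open>M * d\<^sup>2 = d * N\<close> leaves a single factor \<open>d\<close>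
      outside.\<close>
    also have "\<dots> = 0.8 * real d * t powr (real d / 2 - 1) * (real N * exp (- t / 2))"
      by (simp add: b_def N_def power2_eq_square)
    \<comment> \<open>Since \<open>t / 2 = \<alpha> * d * ln N\<close>, the exponential equals
      \<open>N powr (- (\<alpha> * d))\<close>.\<close>
    also have "real N * exp (- t / 2) = 1 / real N powr (\<alpha> * real d - 1)"
      using N0 by (simp add: t_def powr_def algebra_simps exp_diff exp_minus field_simps)
    finally have "measure ?G (\<Union>i<M. B i) < 0.8 * real d * t powr (real d / 2 - 1) / real N powr (\<alpha> * real d - 1)"
      by simp
    moreover have "measure ?G A = 1 - measure ?G (\<Union>i<M. B i)"
      unfolding A_def using B by (intro G.prob_compl) auto
    ultimately show "measure ?G A > 1 - 0.8 * real d * (2 * \<alpha> * real d * ln (real N)) powr (real d / 2 - 1)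
                   / (real N) powr (\<alpha> * real d - 1)"
      by (simp add: t_def)
  next
    fix w idx xs
    assume "w \<in> A" and run: "bomp_run L M d D k (\<lambda>l. mat_vec L N D x l + w l) idx xs"
    then have w: "block_corr L d D w i < \<tau>" if "i < M" for i
      using that by (force simp: A_def B_def)
    note rec = bomp_recovery[OF S_def[THEN meta_eq_to_obj_eq] sparse S_ne w xmin_pos xmin
        cond'[unfolded \<nu>_def \<mu>B_def] run[unfolded N_def]]
    show "S \<subseteq> idx ` {..<k}" by (rule rec(1))
    define g where "g = (1 - (real d - 1) * \<nu> - (real k - 1) * real d * \<mu>B)\<^sup>2"
    have "\<tau>\<^sup>2 = \<sigma>\<^sup>2 * (lam * t)"
      using lam t by (simp add: \<tau>_def power_mult_distrib)
    then have eq: "real k * \<tau>\<^sup>2 / g = 2 * \<alpha> * lam / g * real d * real k * \<sigma>\<^sup>2 * ln (real N)"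
      by (simp add: t_def mult_ac)
    then show "(\<Sum>j<N. (xs (k - 1) j - x j)\<^sup>2)
                  \<le> 2 * \<alpha> * (1 + (real d - 1) * \<nu>)
                     / (1 - (real d - 1) * \<nu> - (real k - 1) * real d * \<mu>B)\<^sup>2
                     * real d * real k * \<sigma>\<^sup>2 * ln (real N)"
      using rec(2) eq unfolding lam_def g_def N_def \<nu>_def \<mu>B_def by (simp only:)
  qed
qed

end
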